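(* Up to isomorphism, there are exactly five connected strongly regular signed graphs (SRSGs) that are $5$-regular and $3$ net-regular, namely $\dot G_1$, $\dot S^1_8$, $\dot S^1_{10}$, $\dot S^2_{10}$ and $\dot S^3_{10}$ (defined in the context). Their parameters are $(6,5,0,4)$ for $\dot G_1$ (complete), $(8,5,-2,4,4)$ for $\dot S^1_8$, $(10,5,-2,4,2)$ for $\dot S^1_{10}$, $(10,5,0,0,1)$ for $\dot S^2_{10}$ and $(10,5,3,0,-2)$ for $\dot S^3_{10}$.
   Context: A signed graph $\dot G=(G,\sigma)$ is a simple graph $G$ (the underlying graph) with a sign function $\sigma:E(G)\to\{+1,-1\}$; its adjacency matrix $A_{\dot G}=(a_{ij})$ has $a_{ij}=\sigma(v_iv_j)$ if $v_i\sim v_j$ and $0$ otherwise. Connectedness and the degree $d(v)$ refer to the underlying graph. $d^+(v)$ and $d^-(v)$ denote the numbers of positive and negative edges at $v$; the net-degree of $v$ is $d^+(v)-d^-(v)$, and $\dot G$ is $\rho$ net-regular if every vertex has net-degree $\rho$. $\dot G$ is homogeneous if all its edges have the same sign. Note $(A_{\dot G}^2)_{ij}$ equals the number of positive walks of length 2 from $v_i$ to $v_j$ minus the number of negative ones (the sign of a walk is the product of its edge signs). $\dot G$ on $n$ vertices is a strongly regular signed graph (SRSG) if it is neither a homogeneous complete graph nor edgeless, and there exist $r\in\mathbb N$ and $a,b,c\in\mathbb Z$ with $(A_{\dot G}^2)_{ii}=r$ for all $i$, $(A_{\dot G}^2)_{ij}=a$ whenever $v_iv_j$ is a positive edge, $=b$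 whenever $v_iv_j$ is a negative edge, and $=c$ whenever $i\ne j$ and $v_i\not\sim v_j$. Its parameters are written $(n,r,a,b,c)$ if $G$ is non-complete and $(n,r,a,b)$ if $G$ is complete. Isomorphism of signed graphs means a graph isomorphism preserving edge signs. The graphs: $\dot G_1$ is $K_6$ whose negative edges form a perfect matching (three pairwise disjoint edges), all other edges positive. For $m\in\{4,5\}$, $\dot S^1_{2m}$ has vertex set $\{x_t,y_t: t\in\mathbb Z_m\}$, with $x_ty_t$ a negative edge for each $t$, all four edges between $\{x_t,y_t\}$ and $\{x_{t+1},y_{t+1}\}$ positive for each $t$, and no other edges (i.e. the lexicographic product $C_m[K_2]$ with the $K_2$-edges negative); $\dot S^1_8$ corresponds to $m=4$ and $\dot S^1_{10}$ to $m=5$. $\dot S^2_{10}$ is the complete bipartite graph $K_{5,5}$ whose negative edges form a perfect matching, all other edges positive. $\dot S^3_{10}$ consists of two vertex-disjoint complete graphs $K_5$ on $\{u_1,\dots,u_5\}$ and $\{w_1,\dots,w_5\}$ with all their edges positive, together with the negative edges $u_tw_t$, $t=1,\dots,5$. *)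

theory Defs
  imports Main
begin

text \<open>A signed graph on a finite vertex set V is encoded by its signed adjacency
  function s: s x y = sigma(xy) if x ~ y, and 0 otherwise (also 0 outside V).\<close>

definition signed_graph :: "'a set \<Rightarrow> ('a \<Rightarrow> 'a \<Rightarrow> int) \<Rightarrow> bool" where
  "signed_graph V s \<longleftrightarrow> finite V \<and>
     (\<forall>x y. s x y \<in> {-1, 0, 1}) \<and> (\<forall>x y. s x y = s y x) \<and> (\<forall>x. s x x = 0) \<and>
     (\<forall>x y. s x y \<noteq> 0 \<longrightarrow> x \<in> V \<and> y \<in> V)"

definition adj :: "'a set \<Rightarrow> ('a \<Rightarrow> 'a \<Rightarrow> int) \<Rightarrow> 'a \<Rightarrow> 'a \<Rightarrow> bool" where
  "adj V s x y \<longleftrightarrow> x \<in> V \<and> y \<in> V \<and> s x y \<noteq> 0"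

definition sg_connected :: "'a set \<Rightarrow> ('a \<Rightarrow> 'a \<Rightarrow> int) \<Rightarrow> bool" where
  "sg_connected V s \<longleftrightarrow> (\<forall>x\<in>V. \<forall>y\<in>V. (adj V s)\<^sup>*\<^sup>* x y)"

definition deg :: "'a set \<Rightarrow> ('a \<Rightarrow> 'a \<Rightarrow> int) \<Rightarrow> 'a \<Rightarrow> nat" where
  "deg V s x = card {y \<in> V. s x y \<noteq> 0}"

definition pos_deg :: "'a set \<Rightarrow> ('a \<Rightarrow> 'a \<Rightarrow> int) \<Rightarrow> 'a \<Rightarrow> nat" where
  "pos_deg V s x = card {y \<in> V. s x y = 1}"

definition neg_deg :: "'a set \<Rightarrow> ('a \<Rightarrow> 'a \<Rightarrow> int) \<Rightarrow> 'a \<Rightarrow> nat" where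
  "neg_deg V s x = card {y \<in> V. s x y = -1}"

definition regular :: "'a set \<Rightarrow> ('a \<Rightarrow> 'a \<Rightarrow> int) \<Rightarrow> nat \<Rightarrow> bool" where
  "regular V s k \<longleftrightarrow> (\<forall>x\<in>V. deg V s x = k)"

definition net_regular :: "'a set \<Rightarrow> ('a \<Rightarrow> 'a \<Rightarrow> int) \<Rightarrow> int \<Rightarrow> bool" where
  "net_regular V s \<rho> \<longleftrightarrow> (\<forall>x\<in>V. int (pos_deg V s x) - int (neg_deg V s x) = \<rho>)"

definition A2 :: "'a set \<Rightarrow> ('a \<Rightarrow> 'a \<Rightarrow> int) \<Rightarrow> 'a \<Rightarrow> 'a \<Rightarrow> int" where
  "A2 V s x y = (\<Sum>z\<in>V. s x z * s z y)"

definition complete :: "'a set \<Rightarrow> ('a \<Rightarrow> 'a \<Rightarrow> int) \<Rightarrow> bool" where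
  "complete V s \<longleftrightarrow> (\<forall>x\<in>V. \<forall>y\<in>V. x \<noteq> y \<longrightarrow> s x y \<noteq> 0)"

definition homogeneous :: "'a set \<Rightarrow> ('a \<Rightarrow> 'a \<Rightarrow> int) \<Rightarrow> bool" where
  "homogeneous V s \<longleftrightarrow> (\<forall>x\<in>V. \<forall>y\<in>V. s x y \<noteq> -1) \<or> (\<forall>x\<in>V. \<forall>y\<in>V. s x y \<noteq> 1)"

definition edgeless :: "'a set \<Rightarrow> ('a \<Rightarrow> 'a \<Rightarrow> int) \<Rightarrow> bool" where
  "edgeless V s \<longleftrightarrow> (\<forall>x\<in>V. \<forall>y\<in>V. s x y = 0)"

definition srsg_with :: "'a set \<Rightarrow> ('a \<Rightarrow> 'a \<Rightarrow> int) \<Rightarrow> nat \<Rightarrow> int \<Rightarrow> int \<Rightarrow> int \<Rightarrow> bool" where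
  "srsg_with V s r a b c \<longleftrightarrow> signed_graph V s \<and>
     \<not> (homogeneous V s \<and> complete V s) \<and> \<not> edgeless V s \<and>
     (\<forall>x\<in>V. A2 V s x x = int r) \<and>
     (\<forall>x\<in>V. \<forall>y\<in>V. s x y = 1 \<longrightarrow> A2 V s x y = a) \<and>
     (\<forall>x\<in>V. \<forall>y\<in>V. s x y = -1 \<longrightarrow> A2 V s x y = b) \<and>
     (\<forall>x\<in>V. \<forall>y\<in>V. x \<noteq> y \<and> s x y = 0 \<longrightarrow> A2 V s x y = c)"

definition srsg :: "'a set \<Rightarrow> ('a \<Rightarrow> 'a \<Rightarrow> int) \<Rightarrow> bool" where
  "srsg V s \<longleftrightarrow> (\<exists>r a b c. srsg_with V s r a b c)"

definition srsg_params4 :: "'a set \<Rightarrow> ('a \<Rightarrow> 'a \<Rightarrow> int) \<Rightarrow> nat \<Rightarrow> nat \<Rightarrow> int \<Rightarrow> int \<Rightarrow> bool" where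
  "srsg_params4 V s n r a b \<longleftrightarrow> complete V s \<and> card V = n \<and> (\<exists>c. srsg_with V s r a b c)"

definition srsg_params5 :: "'a set \<Rightarrow> ('a \<Rightarrow> 'a \<Rightarrow> int) \<Rightarrow> nat \<Rightarrow> nat \<Rightarrow> int \<Rightarrow> int \<Rightarrow> int \<Rightarrow> bool" where
  "srsg_params5 V s n r a b c \<longleftrightarrow> \<not> complete V s \<and> card V = n \<and> srsg_with V s r a b c"

definition sg_iso :: "'a set \<Rightarrow> ('a \<Rightarrow> 'a \<Rightarrow> int) \<Rightarrow> 'b set \<Rightarrow> ('b \<Rightarrow> 'b \<Rightarrow> int) \<Rightarrow> bool" where
  "sg_iso V s W t \<longleftrightarrow> (\<exists>f. bij_betw f V W \<and> (\<forall>x\<in>V. \<forall>y\<in>V. t (f x) (f y) = s x y))"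

definition G1_V :: "nat set" where "G1_V = {0..<6}"
definition G1_s :: "nat \<Rightarrow> nat \<Rightarrow> int" where
  "G1_s x y = (if x \<in> G1_V \<and> y \<in> G1_V \<and> x \<noteq> y then (if x div 2 = y div 2 then -1 else 1) else 0)"

text \<open>S^1_{2m} = C_m[K_2] with K_2-edges negative; x_t = 2t, y_t = 2t+1.\<close>
definition S1_V :: "nat \<Rightarrow> nat set" where "S1_V m = {0..<2*m}"
definition S1_s :: "nat \<Rightarrow> nat \<Rightarrow> nat \<Rightarrow> int" where
  "S1_s m x y = (if x \<in> S1_V m \<and> y \<in> S1_V m \<and> x \<noteq> y then
      (if x div 2 = y div 2 then -1
       else if y div 2 = (x div 2 + 1) mod m \<or> x div 2 = (y div 2 + 1) mod m then 1 else 0)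
     else 0)"

definition S2_V :: "nat set" where "S2_V = {0..<10}"
definition S2_s :: "nat \<Rightarrow> nat \<Rightarrow> int" where
  "S2_s x y = (if x \<in> S2_V \<and> y \<in> S2_V \<and> (x < 5) \<noteq> (y < 5) then
      (if x mod 5 = y mod 5 then -1 else 1) else 0)"

definition S3_V :: "nat set" where "S3_V = {0..<10}"
definition S3_s :: "nat \<Rightarrow> nat \<Rightarrow> int" where
  "S3_s x y = (if x \<in> S3_V \<and> y \<in> S3_V \<and> x \<noteq> y then
      (if (x < 5) = (y < 5) then 1 else if x mod 5 = y mod 5 then -1 else 0) else 0)"

definition is_5_3_srsg :: "'a set \<Rightarrow> ('a \<Rightarrow> 'a \<Rightarrow> int) \<Rightarrow> bool" where
  "is_5_3_srsg V s \<longleftrightarrow> signed_graph V s \<and> sg_connected V s \<and> regular V s 5 \<and>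
     net_regular V s 3 \<and> srsg V s"

end

theory Submission
  imports Defs
begin

text \<open>
  Every vertex has four positive neighbours and exactly one negative one, so the negative edges form a
  perfect matching \<open>m\<close>. Counting rows of \<open>A\<^sup>2\<close> gives \<open>4a + b + c(n - 6) = 4\<close>; as \<open>n\<close> is even and \<open>b\<close> is
  the number of common positive neighbours of \<open>x\<close> and \<open>m x\<close>, we get \<open>b \<in> {0, 2, 4}\<close>. Since \<open>A\<close> commutes
  with \<open>A\<^sup>2\<close>, the matching is an automorphism unless \<open>a + b = 2c\<close>.

  If \<open>b = 4\<close>, mates have the same positive neighbours, and the quotient by the matching is a cycle, of
  length at most 5 because \<open>c\<close> is constant. The case \<open>b = 2\<close> is excluded by a local argument when \<open>m\<close> is
  an automorphism, and by \<open>3 | tr A\<^sup>3\<close> otherwise. If \<open>b = 0\<close>, then \<open>m\<close> is an automorphism and \<open>a\<close> is the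
  number of common positive neighbours of the ends of a positive edge; \<open>a = 1, 2\<close> are impossible, \<open>a = 3\<close> forces
  two positive \<open>K\<^sub>5\<close> joined by \<open>m\<close>, and \<open>a = 0\<close> forces \<open>K\<^sub>5\<^sub>,\<^sub>5\<close>.
\<close>

section \<open>Triangles, degrees and enumerations\<close>

text \<open>The sum is the trace of the cube of the adjacency matrix. A new vertex \<open>w\<close>
  can occur in any of three positions; the three contributions agree by symmetry, and terms
  containing \<open>w\<close> twice vanish for lack of loops.\<close>

lemma three_dvd_sum_triangles:
  fixes s :: "'a \<Rightarrow> 'a \<Rightarrow> int"
  assumes "finite V" and sym: "\<And>x y. s x y = s y x" and irr: "\<And>x. s x x = 0"
  shows "3 dvd (\<Sum>x\<in>V. \<Sum>y\<in>V. \<Sum>z\<in>V. s x y * (s x z * s z y))"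
  using \<open>finite V\<close>
proof induction
  case (insert w V)
  let ?f = "\<lambda>x y z. s x y * (s x z * s z y)"
  have eq: "?f x y z = ?f y x z" "?f x y z = ?f x z y" for x y z
    by (simp_all add: sym[of y x] sym[of z y] sym[of z x] mult.commute mult.left_commute)
  have 0: "?f w w z = 0" "?f w y w = 0" "?f x w w = 0" for x y z by (simp_all add: irr)
  have 1: "(\<Sum>x\<in>V. \<Sum>z\<in>V. ?f x w z) = (\<Sum>y\<in>V. \<Sum>z\<in>V. ?f w y z)"
    by (intro sum.cong refl eq)
  have 2: "(\<Sum>x\<in>V. \<Sum>y\<in>V. ?f x y w) = (\<Sum>y\<in>V. \<Sum>z\<in>V. ?f w y z)"
    by (intro sum.cong refl) (metis eq)
  have "(\<Sum>x\<in>insert w V. \<Sum>y\<in>insert w V. \<Sum>z\<in>insert w V. ?f x y z) =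
      (\<Sum>x\<in>V. \<Sum>y\<in>V. \<Sum>z\<in>V. ?f x y z) + (\<Sum>y\<in>V. \<Sum>z\<in>V. ?f w y z)
      + (\<Sum>x\<in>V. \<Sum>z\<in>V. ?f x w z) + (\<Sum>x\<in>V. \<Sum>y\<in>V. ?f x y w)"
    using insert.hyps by (simp add: sum.distrib 0 irr)
  then show ?case unfolding 1 2 using insert.IH by presburger
qed simp

lemma deg_eq_pos_neg:
  assumes "signed_graph V s"
  shows "deg V s x = pos_deg V s x + neg_deg V s x"
proof -
  have "{y \<in> V. s x y \<noteq> 0} = {y \<in> V. s x y = 1} \<union> {y \<in> V. s x y = -1}"
    using assms by (auto simp: signed_graph_def)
  moreover have "finite V" using assms by (simp add: signed_graph_def)
  ultimately show ?thesis
    unfolding deg_def pos_deg_def neg_deg_def by (simp add: card_Un_disjoint disjoint_iff)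
qed

text \<open>The models live on initial segments of the naturals, so vertices are listed by
  \<open>g\<close> and the isomorphism is the inverse of \<open>g\<close>.\<close>

lemma sg_iso_enum:
  fixes s :: "'a \<Rightarrow> 'a \<Rightarrow> int"
  assumes bij: "bij_betw g {0..<n} V"
    and "\<And>i j. i < n \<Longrightarrow> j < n \<Longrightarrow> t i j = s (g i) (g j)"
  shows "sg_iso V s {0..<n::nat} t"
  unfolding sg_iso_def
proof (intro exI conjI ballI)
  let ?f = "the_inv_into {0..<n} g"
  show "bij_betw ?f V {0..<n}" by (rule bij_betw_the_inv_into[OF bij])
  fix x y assume "x \<in> V" "y \<in> V"
  then have "?f x < n" "?f y < n"
    using bij_betwE[OF bij_betw_the_inv_into[OF bij]] by simp_all
  then show "t (?f x) (?f y) = s x y"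
    using assms(2) \<open>x \<in> V\<close> \<open>y \<in> V\<close> by (simp add: f_the_inv_into_f_bij_betw[OF bij])
qed

subsection \<open>The matching of negative edges\<close>

text \<open>The negative edges are encoded by the function \<open>m\<close>. The diagonal value 5 of
  A^2 is not assumed but follows from the degrees.\<close>

locale matched_srsg =
  fixes V :: "'a set" and s :: "'a \<Rightarrow> 'a \<Rightarrow> int" and m :: "'a \<Rightarrow> 'a" and a b c :: int
  assumes signed: "signed_graph V s" and connected: "sg_connected V s" and nonempty: "V \<noteq> {}"
    and card_pos: "x \<in> V \<Longrightarrow> card {y. s x y = 1} = 4"
    and mate: "x \<in> V \<Longrightarrow> s x y = -1 \<longleftrightarrow> y = m x"
    and A2_pos: "x \<in> V \<Longrightarrow> y \<in> V \<Longrightarrow> s x y = 1 \<Longrightarrow> A2 V s x y = a"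
    and A2_neg: "x \<in> V \<Longrightarrow> y \<in> V \<Longrightarrow> s x y = -1 \<Longrightarrow> A2 V s x y = b"
    and A2_non: "x \<in> V \<Longrightarrow> y \<in> V \<Longrightarrow> x \<noteq> y \<Longrightarrow> s x y = 0 \<Longrightarrow> A2 V s x y = c"
begin

definition N :: "'a \<Rightarrow> 'a set" where "N x = {y. s x y = 1}"

lemma finite_V: "finite V" and s_sym: "s x y = s y x" and s_irrefl: "s x x = 0"
  and s_range: "s x y = -1 \<or> s x y = 0 \<or> s x y = 1"
  and s_V: "s x y \<noteq> 0 \<Longrightarrow> x \<in> V" "s x y \<noteq> 0 \<Longrightarrow> y \<in> V"
  using signed unfolding signed_graph_def by auto

lemma N_V: "y \<in> N x \<Longrightarrow> x \<in> V" "y \<in> N x \<Longrightarrow> y \<in> V"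
  using s_V[of x y] by (auto simp: N_def)

lemma N_sym: "y \<in> N x \<longleftrightarrow> x \<in> N y"
  by (simp add: N_def s_sym[of x y])

lemma N_irrefl: "x \<notin> N x"
  by (simp add: N_def s_irrefl)

lemma N_finite: "finite (N x)"
  using finite_subset[of "N x" V] N_V finite_V by blast

lemma N_card: "x \<in> V \<Longrightarrow> card (N x) = 4"
  by (simp add: N_def card_pos)

lemma m_V: "x \<in> V \<Longrightarrow> m x \<in> V"
  using mate[of x "m x"] s_V[of x "m x"] by simp

lemma m_neq: "x \<in> V \<Longrightarrow> m x \<noteq> x"
  using mate[of x "m x"] s_irrefl[of x] by auto

lemma m_m: "x \<in> V \<Longrightarrow> m (m x) = x"
  using mate[of x "m x"] mate[of "m x" x] m_V[of x] s_sym[of x "m x"] by simp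

lemma m_eq_iff: "x \<in> V \<Longrightarrow> y \<in> V \<Longrightarrow> m x = m y \<longleftrightarrow> x = y"
  using m_m by metis

lemma m_eq_swap: "x \<in> V \<Longrightarrow> y \<in> V \<Longrightarrow> m x = y \<longleftrightarrow> x = m y"
  using m_m by metis

lemma m_notin_N: "x \<in> V \<Longrightarrow> m x \<notin> N x"
  using mate[of x "m x"] by (simp add: N_def)

section \<open>Entries of A and of its square\<close>

text \<open>In matrix form A = P - M, where P is the adjacency matrix of the positive edges and M
  the permutation matrix of \<open>m\<close>.\<close>

lemma s_eq: "x \<in> V \<Longrightarrow> s x y = of_bool (y \<in> N x) - of_bool (y = m x)"
  using s_range[of x y] mate[of x y] m_notin_N[of x] by (auto simp: N_def)

lemma s_eq': "x \<in> V \<Longrightarrow> y \<in> V \<Longrightarrow> s x y = of_bool (x \<in> N y) - of_bool (x = m y)"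
  using s_eq[of y x] s_sym[of x y] by simp

lemma sum_N: "(\<Sum>z\<in>V. of_bool (z \<in> N x) * f z :: int) = (\<Sum>z\<in>N x. f z)"
proof -
  have "(\<Sum>z\<in>N x. f z) = (\<Sum>z\<in>N x. of_bool (z \<in> N x) * f z)" by simp
  also have "\<dots> = (\<Sum>z\<in>V. of_bool (z \<in> N x) * f z)"
    using N_V finite_V by (intro sum.mono_neutral_left) auto
  finally show ?thesis by simp
qed

lemma sum_N_of_bool: "(\<Sum>z\<in>N x. of_bool (z \<in> N y) :: int) = int (card (N x \<inter> N y))"
  using N_finite[of x] by simp

lemma sum_N_single: "(\<Sum>z\<in>N x. of_bool (z = y) :: int) = of_bool (y \<in> N x)"
proof -
  have "N x \<inter> {z. z = y} = (if y \<in> N x then {y} else {})" by auto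
  then show ?thesis using N_finite[of x] by simp
qed

lemma sum_single: "y \<in> V \<Longrightarrow> (\<Sum>z\<in>V. of_bool (z = y) * f z :: int) = f y"
proof -
  assume "y \<in> V"
  then have "V \<inter> {z. z = y} = {y}" by auto
  then show ?thesis using finite_V by (simp add: of_bool_def if_distrib[of "\<lambda>t. t * _"] \<open>y \<in> V\<close> cong: if_cong)
qed

lemma sum_N_s:
  assumes "x \<in> V" "y \<in> V"
  shows "(\<Sum>z\<in>N x. s z y) = int (card (N x \<inter> N y)) - of_bool (m y \<in> N x)"
proof -
  have "(\<Sum>z\<in>N x. s z y) = (\<Sum>z\<in>N x. of_bool (z \<in> N y) - of_bool (z = m y))"
    using N_V assms by (intro sum.cong refl s_eq') auto
  then show ?thesis by (simp only: sum_subtractf sum_N_of_bool sum_N_single)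
qed

lemma sum_s:
  assumes "x \<in> V"
  shows "(\<Sum>z\<in>V. s x z * f z) = (\<Sum>z\<in>N x. f z) - f (m x)"
proof -
  have "(\<Sum>z\<in>V. s x z * f z) = (\<Sum>z\<in>V. of_bool (z \<in> N x) * f z - of_bool (z = m x) * f z)"
    using assms by (intro sum.cong refl) (simp add: s_eq left_diff_distrib)
  then show ?thesis using m_V[OF assms] by (simp only: sum_subtractf sum_N sum_single)
qed

lemma row_sum: "x \<in> V \<Longrightarrow> (\<Sum>z\<in>V. s x z) = 3"
  using sum_s[of x "\<lambda>_. 1"] by (simp add: N_card)

text \<open>This is A^2 = P^2 - PM - MP + M^2 read entrywise, with M^2 = I because \<open>m\<close>
  is an involution.\<close>

lemma A2_eq:
  assumes "x \<in> V" "y \<in> V"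
  shows "A2 V s x y = int (card (N x \<inter> N y)) - of_bool (m y \<in> N x) - of_bool (y \<in> N (m x)) + of_bool (x = y)"
proof -
  have "A2 V s x y = (\<Sum>z\<in>N x. s z y) - s (m x) y"
    unfolding A2_def by (rule sum_s[OF assms(1)])
  also have "s (m x) y = of_bool (y \<in> N (m x)) - of_bool (x = y)"
    using s_eq[of "m x" y] assms(1) by (simp add: m_V m_m eq_commute)
  finally show ?thesis using assms by (simp add: sum_N_s)
qed

text \<open>The SRSG conditions as one identity: A^2 = (5 - c)I + (a - c)P + (b - c)M + cJ, with J
  the all-ones matrix.\<close>

lemma A2_params:
  assumes "x \<in> V" "y \<in> V"
  shows "A2 V s x y = (5 - c) * of_bool (y = x) + (a - c) * of_bool (y \<in> N x) + (b - c) * of_bool (y = m x) + c"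
proof (cases "x = y")
  case True
  have "m x \<notin> N x" using m_notin_N assms by blast
  then show ?thesis using True assms m_neq[of x]
    by (auto simp: A2_eq N_card N_irrefl N_sym)
next
  case False
  then show ?thesis
    using assms A2_pos[of x y] A2_neg[of x y] A2_non[of x y] mate[of x y] s_range[of x y] m_notin_N[of x]
    by (auto simp: N_def)
qed

text \<open>Equating \<open>A2_eq\<close> with the prescribed entry turns \<open>a\<close> into a
  count of common positive neighbours, up to two correction terms; the next two lemmas treat
  \<open>b\<close> and \<open>c\<close> likewise.\<close>

lemma card_common_pos:
  assumes "y \<in> N x"
  shows "int (card (N x \<inter> N y)) = a + of_bool (m y \<in> N x) + of_bool (y \<in> N (m x))"
proof -
  have "s x y = 1" "x \<noteq> y" using assms N_irrefl by (auto simp: N_def)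
  then show ?thesis using A2_eq[of x y] A2_pos[of x y] N_V[OF assms] by simp
qed

lemma card_common_neg:
  assumes "x \<in> V"
  shows "int (card (N x \<inter> N (m x))) = b"
  using A2_eq[of x "m x"] A2_neg[of x "m x"] assms m_V[of x] mate[of x "m x"] m_neq[of x]
  by (simp add: m_m N_irrefl)

lemma card_common_non:
  assumes "x \<in> V" "y \<in> V" "y \<noteq> x" "y \<noteq> m x" "y \<notin> N x"
  shows "int (card (N x \<inter> N y)) = c + of_bool (m y \<in> N x) + of_bool (y \<in> N (m x))"
  using A2_eq[of x y] A2_params[of x y] assms by simp

subsection \<open>Relations between the parameters\<close>

text \<open>All row sums of A are 3, so those of A^2 are 9, while a row of \<open>A2_params\<close>
  sums to 5 + 4a + b + c(n - 6).\<close>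

lemma param_count: "4 * a + b + c * (int (card V) - 6) = 4"
proof -
  obtain x where x: "x \<in> V" using nonempty by blast
  have "(\<Sum>y\<in>V. A2 V s x y) = (\<Sum>z\<in>V. s x z * (\<Sum>y\<in>V. s z y))"
    unfolding A2_def by (subst sum.swap) (simp add: sum_distrib_left)
  also have "\<dots> = (\<Sum>z\<in>V. s x z * 3)" by (intro sum.cong refl) (simp add: row_sum)
  also have "\<dots> = 9" by (simp add: row_sum[OF x] flip: sum_distrib_right)
  finally have 1: "(\<Sum>y\<in>V. A2 V s x y) = 9" .
  have 2: "(\<Sum>y\<in>V. of_bool (y = x)) = (1::int)" "(\<Sum>y\<in>V. of_bool (y = m x)) = (1::int)"
    "(\<Sum>y\<in>V. of_bool (y \<in> N x)) = (4::int)"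
    using sum_single[OF x, of "\<lambda>_. 1"] sum_single[OF m_V[OF x], of "\<lambda>_. 1"] sum_N[of x "\<lambda>_. 1"]
    by (simp_all add: N_card[OF x])
  have "(\<Sum>y\<in>V. A2 V s x y) =
    (\<Sum>y\<in>V. (5 - c) * of_bool (y = x) + (a - c) * of_bool (y \<in> N x) + (b - c) * of_bool (y = m x) + c)"
    by (intro sum.cong refl A2_params x)
  also have "\<dots> = (5 - c) + (a - c) * 4 + (b - c) + int (card V) * c"
    by (simp only: sum.distrib 2 mult_1_right sum_constant flip: sum_distrib_left)
  finally show ?thesis using 1 by (simp add: algebra_simps)
qed

text \<open>\<open>A2_params\<close> multiplied by A on the right; J contributes 3c because the
  columns of A sum to 3.\<close>

lemma A2_mult_left:
  assumes "x \<in> V" "y \<in> V"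
  shows "(\<Sum>w\<in>V. A2 V s x w * s w y) = (5 - c) * s x y + (a - c) * (\<Sum>w\<in>N x. s w y) + (b - c) * s (m x) y + 3 * c"
proof -
  have "(\<Sum>w\<in>V. A2 V s x w * s w y) =
     (\<Sum>w\<in>V. (5 - c) * (of_bool (w = x) * s w y) + (a - c) * (of_bool (w \<in> N x) * s w y)
        + (b - c) * (of_bool (w = m x) * s w y) + c * s y w)"
    using assms by (intro sum.cong refl) (simp add: A2_params algebra_simps s_sym[of y])
  also have "\<dots> = (5 - c) * s x y + (a - c) * (\<Sum>w\<in>N x. s w y) + (b - c) * s (m x) y + c * 3"
    using assms m_V[OF assms(1)]
    by (simp only: sum.distrib sum_N sum_single row_sum flip: sum_distrib_left)
  finally show ?thesis by simp
qed

text \<open>Comparing \<open>A\<^sup>2 A\<close> with \<open>A A\<^sup>2\<close>: the matching either is an automorphism or \<open>a + b = 2c\<close>.\<close>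

lemma mate_commutes:
  assumes "a + b \<noteq> 2 * c" "x \<in> V" "y \<in> V"
  shows "y \<in> N (m x) \<longleftrightarrow> m y \<in> N x"
proof -
  have A2_sym: "A2 V s u w = A2 V s w u" for u w
    unfolding A2_def by (intro sum.cong refl) (simp add: s_sym mult.commute)
  have "(\<Sum>w\<in>V. A2 V s x w * s w y) = (\<Sum>w\<in>V. \<Sum>z\<in>V. s x z * s z w * s w y)"
    unfolding A2_def by (simp add: sum_distrib_right)
  also have "\<dots> = (\<Sum>z\<in>V. \<Sum>w\<in>V. s x z * s z w * s w y)" by (rule sum.swap)
  also have "\<dots> = (\<Sum>z\<in>V. s x z * A2 V s z y)"
    unfolding A2_def by (simp add: sum_distrib_left mult.assoc)
  \<comment> \<open>A and A^2 are symmetric, so entry (x, y) of A A^2 is entry (y, x) of A^2 A, and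
    one expansion serves both sides.\<close>
  also have "\<dots> = (\<Sum>w\<in>V. A2 V s y w * s w x)"
    by (intro sum.cong refl) (metis A2_sym s_sym mult.commute)
  finally have "(5 - c) * s x y + (a - c) * (\<Sum>w\<in>N x. s w y) + (b - c) * s (m x) y + 3 * c
      = (5 - c) * s y x + (a - c) * (\<Sum>w\<in>N y. s w x) + (b - c) * s (m y) x + 3 * c"
    using assms(2,3) by (simp add: A2_mult_left)
  moreover have "s (m x) y = of_bool (y \<in> N (m x)) - of_bool (x = y)"
    using s_eq[of "m x" y] assms(2) by (simp add: m_V m_m eq_commute)
  moreover have "s (m y) x = of_bool (m y \<in> N x) - of_bool (x = y)"
    using s_eq[of "m y" x] assms(3) by (simp add: m_V m_m N_sym[of x])
  \<comment> \<open>Putting A = P - M, the terms in P^2 and M^2 cancel and (a + b - 2c)(MP - PM) = 0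
    remains.\<close>
  ultimately have "(a + b - 2 * c) * of_bool (y \<in> N (m x)) = (a + b - 2 * c) * of_bool (m y \<in> N x)"
    using assms(2,3) by (simp add: sum_N_s s_sym[of y x] Int_commute[of "N y"] N_sym[of "m x" y] algebra_simps)
  then show ?thesis using assms(1) by (cases "y \<in> N (m x)"; cases "m y \<in> N x") simp_all
qed

lemma even_card_V: "even (card V)"
proof -
  define C where "C = (\<lambda>x. {x, m x}) ` V"
  have V: "\<Union>C = V" unfolding C_def using m_V by auto
  have "2 dvd card (\<Union>C)"
  proof (rule dvd_partition)
    show "finite (\<Union>C)" using V finite_V by simp
    show "\<forall>A\<in>C. 2 dvd card A" unfolding C_def using m_neq by (auto simp: card_insert_if eq_commute)
    show "\<forall>A\<in>C. \<forall>B\<in>C. A \<noteq> B \<longrightarrow> A \<inter> B = {}"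
      unfolding C_def using m_m by (auto simp: m_eq_iff)
  qed
  then show ?thesis by (simp add: V)
qed

lemma card_V_ge: "card V \<ge> 6"
proof -
  obtain x where x: "x \<in> V" using nonempty by blast
  have "card (insert x (insert (m x) (N x))) = 6"
    using x m_neq[OF x] m_notin_N[OF x] by (simp add: N_finite N_irrefl N_card)
  moreover have "insert x (insert (m x) (N x)) \<subseteq> V" using x m_V[OF x] N_V by auto
  ultimately show ?thesis using card_mono[OF finite_V] by metis
qed

text \<open>The form in which connectedness is used: the neighbours of \<open>u\<close> are
  \<open>N u\<close> together with \<open>m u\<close>.\<close>

lemma closed_subset_eq:
  assumes "x \<in> W" "W \<subseteq> V" "\<And>u. u \<in> W \<Longrightarrow> N u \<subseteq> W" "\<And>u. u \<in> W \<Longrightarrow> m u \<in> W"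
  shows "W = V"
proof -
  have "y \<in> W" if "y \<in> V" for y
  proof -
    have "(adj V s)\<^sup>*\<^sup>* x y" using connected assms that unfolding sg_connected_def by blast
    then show ?thesis
    proof induction
      case (step y z)
      then have "s y z = 1 \<or> s y z = -1" using s_range[of y z] by (auto simp: adj_def)
      then show ?case using assms(3,4)[of y] step mate[of y z] by (auto simp: N_def adj_def)
    qed (use assms in simp)
  qed
  then show ?thesis using assms(2) by blast
qed

text \<open>The bounds hold because \<open>b\<close> counts common positive neighbours of mates;
  evenness comes from \<open>param_count\<close>, where \<open>int (card V) - 6\<close> is
  even.\<close>

lemma b_cases: "b = 0 \<or> b = 2 \<or> b = 4"
proof -
  obtain x where x: "x \<in> V" using nonempty by blast
  have "card (N x \<inter> N (m x)) \<le> 4"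
    using card_mono[OF N_finite, of "N x \<inter> N (m x)" x] N_card[OF x] by simp
  then have "0 \<le> b" "b \<le> 4" using card_common_neg[OF x] by auto
  moreover have "even b"
  proof -
    have "b = 4 - 4 * a - c * (int (card V) - 6)" using param_count by simp
    moreover have "even (int (card V) - 6)" using even_card_V by simp
    ultimately show ?thesis by simp
  qed
  ultimately show ?thesis by presburger
qed

subsection \<open>The case \<open>b = 2\<close>\<close>

text \<open>The common positive neighbours of \<open>x\<close> and \<open>m x\<close> form a pair
  \<open>u\<close>, \<open>m u\<close>. With \<open>v\<close>, \<open>w\<close> the other positive
  neighbours of \<open>x\<close>, counting joins \<open>u\<close> to both, and \<open>comm\<close>
  joins it to \<open>m v\<close>. Then \<open>u\<close> has five positive neighbours
  \<open>x\<close>, \<open>m x\<close>, \<open>v\<close>, \<open>w\<close>,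
  \<open>m v\<close>.\<close>

lemma b_neq_2_if_mate_commutes:
  assumes comm: "\<And>x y. x \<in> V \<Longrightarrow> y \<in> V \<Longrightarrow> y \<in> N (m x) \<longleftrightarrow> m y \<in> N x"
  shows "b \<noteq> 2"
proof
  assume b: "b = 2"
  obtain x where x: "x \<in> V" using nonempty by blast
  have card2: "card (N x \<inter> N (m x)) = 2" using card_common_neg[OF x] b by simp
  then have "N x \<inter> N (m x) \<noteq> {}" by force
  then obtain u where u: "u \<in> N x" "u \<in> N (m x)" by blast
  note V = x m_V[OF x] N_V(2)[OF u(1)] m_V[OF N_V(2)[OF u(1)]]
  have mu: "m u \<in> N x" "m u \<in> N (m x)" using comm[of x u] comm[of x "m u"] u V by (auto simp: m_m)
  have uu: "N x \<inter> N (m x) = {u, m u}"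
    using card_seteq[of "N x \<inter> N (m x)" "{u, m u}"] u mu card2 m_neq[of u] V N_finite by auto
  have "card (N x - {u, m u}) = 2"
    using u mu m_neq[of u] V by (simp add: card_Diff_subset N_card)
  then obtain v w where vw: "N x - {u, m u} = {v, w}" "v \<noteq> w" by (auto simp: card_2_iff)
  then have Nx: "N x = {u, m u, v, w}" "v \<notin> {u, m u}" "w \<notin> {u, m u}" using u mu by auto
  have v: "v \<in> N x" "v \<notin> N (m x)" "w \<in> N x" "w \<notin> N (m x)" using Nx uu by auto
  have vV: "v \<in> V" "w \<in> V" using v N_V by auto
  have "m v \<notin> N x" using comm[of x v] v V vV by blast
  \<comment> \<open>For \<open>v\<close> both correction terms of \<open>card_common_pos\<close>
    vanish, so \<open>a\<close> is itself a cardinality.\<close>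
  then have "a \<ge> 0" using card_common_pos[OF v(1)] v by simp
  have thick: "{v, w} \<subseteq> N q" if q: "q \<in> {u, m u}" for q
  proof -
    have qN: "q \<in> N x" "q \<in> N (m x)" "m q \<in> N x" using q u mu V by (auto simp: m_m)
    \<comment> \<open>For \<open>q\<close> both correction terms are 1, so at least two common
      neighbours are needed, and only \<open>v\<close> and \<open>w\<close> are available.\<close>
    then have "int (card (N x \<inter> N q)) = a + 2" using card_common_pos[of q x] by simp
    moreover have sub: "N x \<inter> N q \<subseteq> {v, w}"
      using q Nx N_irrefl[of q] m_notin_N[of q] V by (auto simp: m_m)
    ultimately have "card (N x \<inter> N q) \<ge> card {v, w}"
      using \<open>a \<ge> 0\<close> by (simp add: vw(2))
    then have "N x \<inter> N q = {v, w}" using card_seteq[OF _ sub] by simp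
    then show ?thesis by blast
  qed
  have mv: "m v \<in> N u"
    using thick[of "m u"] comm[of u v] V vV by (simp add: N_sym)
  have "m v \<noteq> w" "v \<noteq> x" "w \<noteq> x" "v \<noteq> m x" "w \<noteq> m x"
    using v \<open>m v \<notin> N x\<close> N_irrefl m_notin_N[OF x] by auto
  moreover have "m v \<noteq> x" "m v \<noteq> m x"
    using \<open>v \<noteq> m x\<close> \<open>v \<noteq> x\<close> vV m_m[of v] m_eq_iff[of v x] x by auto
  ultimately have "card {x, m x, v, w, m v} = 5"
    using vw(2) m_neq[of x] m_neq[of v] x vV by (simp add: eq_commute)
  moreover have "{x, m x, v, w, m v} \<subseteq> N u"
    using thick[of u] mv u N_sym[of u] by auto
  ultimately show False
    using card_mono[OF N_finite, of "{x, m x, v, w, m v}" u] N_card[of u] V by simp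
qed

text \<open>If the matching is not an automorphism, the parameters are \<open>(8, 5, 0, 2, 1)\<close> and the trace of
  \<open>A\<^sup>3\<close> is \<open>-16\<close>, which is not divisible by 3.\<close>

lemma b_neq_2: "b \<noteq> 2"
proof
  assume b: "b = 2"
  then have "a + b = 2 * c"
    using b_neq_2_if_mate_commutes mate_commutes by blast
  then have a: "a = 2 * c - 2" using b by simp
  then have 1: "c * (int (card V) + 2) = 10" using param_count b by (simp add: algebra_simps)
  then have "c > 0" using mult_nonpos_nonneg[of c "int (card V) + 2"] by fastforce
  have "c = 1"
  proof (rule ccontr)
    assume "c \<noteq> 1"
    \<comment> \<open>The order is at least 6, so the second factor is at least 8 and
      \<open>c\<close> at least 2 would exceed 10.\<close>
    then have "2 * 8 \<le> c * (int (card V) + 2)"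
      using \<open>c > 0\<close> card_V_ge by (intro mult_mono) auto
    then show False using 1 by simp
  qed
  then have n: "card V = 8" and a0: "a = 0" using 1 a by simp_all
  \<comment> \<open>Each vertex contributes 4a - b = -2 to the trace of A^3.\<close>
  have "(\<Sum>y\<in>V. s x y * A2 V s x y) = -2" if x: "x \<in> V" for x
  proof -
    have "(\<Sum>y\<in>V. s x y * A2 V s x y) = (\<Sum>y\<in>N x. A2 V s x y) - A2 V s x (m x)"
      by (rule sum_s[OF x])
    also have "(\<Sum>y\<in>N x. A2 V s x y) = 0"
      using A2_pos N_V a0 by (intro sum.neutral) (auto simp: N_def)
    also have "A2 V s x (m x) = 2"
      using A2_neg[of x "m x"] mate[of x "m x"] x m_V b by simp
    finally show ?thesis by simp
  qed
  then have "(\<Sum>x\<in>V. \<Sum>y\<in>V. s x y * A2 V s x y) = -16" by (simp add: n)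
  moreover have "3 dvd (\<Sum>x\<in>V. \<Sum>y\<in>V. s x y * A2 V s x y)"
    using three_dvd_sum_triangles[OF finite_V s_sym s_irrefl]
    by (simp add: A2_def sum_distrib_left)
  ultimately show False by simp
qed

subsection \<open>The case \<open>b = 0\<close>\<close>

lemma m_image_card: "A \<subseteq> V \<Longrightarrow> card (m ` A) = card A"
  by (intro card_image inj_onI) (metis m_m subsetD)

text \<open>Serves both models with b = 0: \<open>p = 0\<close>, \<open>q = 1\<close> gives the
  signed complete bipartite graph, \<open>p = 1\<close>, \<open>q = 0\<close> the two positive
  complete graphs. The half \<open>A\<close> receives the labels 0 to 4, and the mate of label i is
  i + 5.\<close>

lemma half_iso:
  assumes A: "card A = 5" "A \<subseteq> V" "A \<inter> m ` A = {}" and cV: "card V = 10"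
    and same: "\<And>u w. u \<in> A \<Longrightarrow> w \<in> A \<Longrightarrow> u \<noteq> w \<Longrightarrow> s u w = p \<and> s (m u) (m w) = p"
    and cross: "\<And>u w. u \<in> A \<Longrightarrow> w \<in> A \<Longrightarrow> u \<noteq> w \<Longrightarrow> s u (m w) = q"
    and t: "\<And>i j. i < 10 \<Longrightarrow> j < 10 \<Longrightarrow> t i j = (if (i < 5) = (j < 5) then if i = j then 0 else p
               else if i mod 5 = j mod 5 then -1 else q)"
  shows "sg_iso V s {0..<10::nat} t"
proof -
  obtain xs where "set xs = A" "distinct xs"
    using finite_distinct_list[OF finite_subset[OF A(2) finite_V]] by blast
  then have xs: "set xs = A" "distinct xs" "length xs = 5"
    using A(1) distinct_card[of xs] by simp_all
  define g where "g i = (if i < 5 then xs ! i else m (xs ! (i mod 5)))" for i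
  have xsV: "xs ! i \<in> V" "xs ! i \<in> A" if "i < 5" for i using that xs A(2) by auto
  have xs_eq: "xs ! i = xs ! j \<longleftrightarrow> i = j" if "i < 5" "j < 5" for i j
    using that xs by (simp add: nth_eq_iff_index_eq)
  have cross': "xs ! i \<noteq> m (xs ! j)" if "i < 5" "j < 5" for i j
    using A(3) xsV that by blast
  have mod5: "i mod 5 = i - 5" if "5 \<le> i" "i < 10" for i :: nat
    using that by (simp add: le_mod_geq)
  have inj: "inj_on g {0..<10}"
  proof (rule inj_onI)
    fix i j :: nat assume "i \<in> {0..<10}" "j \<in> {0..<10}" "g i = g j"
    then show "i = j"
      using xs_eq cross'[of i "j mod 5"] cross'[of j "i mod 5"] mod5[of i] mod5[of j] xsV
      by (auto simp: g_def m_eq_iff split: if_splits)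
  qed
  have "g ` {0..<10} \<subseteq> V" using xsV m_V by (auto simp: g_def)
  then have "g ` {0..<10} = V"
    using card_image[OF inj] cV by (intro card_subset_eq finite_V) auto
  then have bij: "bij_betw g {0..<10} V" using inj by (simp add: bij_betw_def)
  have "t i j = s (g i) (g j)" if ij: "i < 10" "j < 10" for i j
  proof -
    have neg: "s (xs ! k) (m (xs ! k)) = -1" if "k < 5" for k using xsV[OF that] mate by blast
    let ?k = "\<lambda>i::nat. i mod 5"
    have k: "?k i < 5" "?k j < 5" by auto
    have gi: "g i = (if i < 5 then xs ! ?k i else m (xs ! ?k i))" "g j = (if j < 5 then xs ! ?k j else m (xs ! ?k j))"
      by (simp_all add: g_def)
    have eqk: "i = j \<longleftrightarrow> ?k i = ?k j" if "(i < 5) = (j < 5)"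
      using that ij mod5[of i] mod5[of j] by (cases "i < 5") auto
    show ?thesis
    proof (cases "?k i = ?k j")
      case True
      then show ?thesis using eqk neg[OF k(1)] s_irrefl s_sym[of "m _"]
        by (auto simp: t[OF ij] gi)
    next
      case False
      then have ne: "xs ! ?k i \<noteq> xs ! ?k j" using xs_eq[OF k] by simp
      note 1 = same[OF xsV(2)[OF k(1)] xsV(2)[OF k(2)] ne]
        cross[OF xsV(2)[OF k(1)] xsV(2)[OF k(2)] ne] cross[OF xsV(2)[OF k(2)] xsV(2)[OF k(1)] ne[symmetric]]
      show ?thesis using 1 False eqk s_sym[of "m (xs ! ?k i)" "xs ! ?k j"]
        by (auto simp: t[OF ij] gi)
    qed
  qed
  then show ?thesis using sg_iso_enum[OF bij] by blast
qed

context
  assumes b0: "b = 0"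
begin

lemma disjoint_mate: "x \<in> V \<Longrightarrow> y \<in> N x \<Longrightarrow> y \<notin> N (m x)"
  using card_common_neg[of x] b0 N_finite[of x] by auto

lemma mate_nbr_notin: "x \<in> V \<Longrightarrow> y \<in> N x \<Longrightarrow> m y \<notin> N x"
  using disjoint_mate[of y x] N_V N_sym by blast

lemma card_common_pos_b0: "y \<in> N x \<Longrightarrow> int (card (N x \<inter> N y)) = a"
  using card_common_pos[of y x] disjoint_mate mate_nbr_notin N_V by simp

text \<open>As mates share no positive neighbour, \<open>N x\<close> is disjoint from its image
  under \<open>m\<close>, giving 1 + 1 + 4 + 4 distinct vertices and hence the bound on the
  order.\<close>

lemma ball2_card:
  assumes "x \<in> V"
  shows "card ({x, m x} \<union> (N x \<union> m ` N x)) = 10"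
proof -
  have NV: "N x \<subseteq> V" using N_V by blast
  have "N x \<inter> m ` N x = {}" using mate_nbr_notin[OF assms] by auto
  then have "card (N x \<union> m ` N x) = 8"
    using N_finite m_image_card[OF NV] N_card[OF assms] by (simp add: card_Un_disjoint)
  moreover have "{x, m x} \<inter> (N x \<union> m ` N x) = {}"
    using assms N_irrefl[of x] m_notin_N[of x] NV by (auto simp: m_eq_iff m_m)
  ultimately show ?thesis
    using m_neq[OF assms] N_finite by (subst card_Un_disjoint) auto
qed

lemma card_V_ge_10: "card V \<ge> 10"
proof -
  obtain x where x: "x \<in> V" using nonempty by blast
  have "{x, m x} \<union> (N x \<union> m ` N x) \<subseteq> V" using x m_V N_V by auto
  then show ?thesis using card_mono[OF finite_V] ball2_card[OF x] by metis
qed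

text \<open>The exceptional case of \<open>mate_commutes\<close> would turn
  \<open>param_count\<close> into c(n + 2) = 4, impossible for n at least 10.\<close>

lemma mate_commutes_b0:
  assumes "x \<in> V" "y \<in> V"
  shows "y \<in> N (m x) \<longleftrightarrow> m y \<in> N x"
proof (rule mate_commutes[OF _ assms])
  show "a + b \<noteq> 2 * c"
  proof
    assume "a + b = 2 * c"
    then have 1: "c * (int (card V) + 2) = 4" using param_count b0 by (simp add: algebra_simps)
    then have "c > 0" using mult_nonpos_nonneg[of c "int (card V) + 2"] by fastforce
    then have "1 * 12 \<le> c * (int (card V) + 2)"
      using card_V_ge_10 by (intro mult_mono) auto
    then show False using 1 by simp
  qed
qed

lemma mate_aut: "x \<in> V \<Longrightarrow> y \<in> V \<Longrightarrow> m y \<in> N (m x) \<longleftrightarrow> y \<in> N x"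
  using mate_commutes_b0[of x "m y"] by (simp add: m_V m_m)

lemma card_common_non_b0:
  assumes "x \<in> V" "y \<in> V" "y \<noteq> x" "y \<noteq> m x" "y \<notin> N x"
  shows "int (card (N x \<inter> N y)) = c + 2 * of_bool (y \<in> N (m x))"
  using card_common_non[OF assms] mate_commutes_b0[OF assms(1,2)] by simp

text \<open>Since \<open>m\<close> is an automorphism, \<open>m p\<close> is a positive neighbour of
  \<open>m x\<close>, so the correction in \<open>card_common_non_b0\<close> is exactly 2.\<close>

lemma card_common_mate_nbr:
  assumes "x \<in> V" "p \<in> N x"
  shows "int (card (N x \<inter> N (m p))) = c + 2"
proof -
  have pV: "p \<in> V" "p \<noteq> x" "p \<noteq> m x" using assms N_V N_irrefl m_notin_N[of x] by auto
  then have "m p \<noteq> x" "m p \<noteq> m x" "m p \<notin> N x"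
    using assms m_eq_iff m_eq_swap mate_nbr_notin by auto
  then show ?thesis
    using card_common_non_b0[of x "m p"] mate_aut[of x p] assms pV m_V by simp
qed

section \<open>Possible values of \<open>a\<close> when b = 0\<close>

lemma param_count_b0: "c * (int (card V) - 6) = 4 - 4 * a"
  using param_count b0 by simp

lemma a_range: "0 \<le> a" "a \<le> 3"
proof -
  obtain x where x: "x \<in> V" using nonempty by blast
  then obtain p where p: "p \<in> N x" using N_card[OF x] by fastforce
  have "card (N x \<inter> N p) \<le> card (N x - {p})"
    using N_finite N_irrefl by (intro card_mono) auto
  then show "0 \<le> a" "a \<le> 3"
    using card_common_pos_b0[OF p] N_card[OF x] p by (simp_all add: N_finite)
qed

text \<open>Let \<open>q\<close> be the one positive neighbour of \<open>p\<close> outside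
  \<open>x\<close> and \<open>N x\<close>. Counting makes \<open>N p \<inter> N q\<close> equal to
  \<open>N x \<inter> N p\<close>, so \<open>x\<close> and \<open>q\<close> share these two vertices
  and \<open>p\<close>. This forces \<open>c\<close> to be positive, against c(n - 6) = -4.\<close>

lemma a_neq_2: "a \<noteq> 2"
proof
  assume a: "a = 2"
  obtain x where x: "x \<in> V" using nonempty by blast
  then obtain p where p: "p \<in> N x" using N_card[OF x] by fastforce
  have pV: "p \<in> V" and xp: "x \<in> N p" using p N_V N_sym by auto
  have c2: "card (N x \<inter> N p) = 2" using card_common_pos_b0[OF p] a by simp
  have "card (N p - (insert x (N x \<inter> N p))) = 1"
    using xp c2 N_card[OF pV] N_irrefl[of x] N_finite by (subst card_Diff_subset) auto
  then obtain q where q: "N p - (insert x (N x \<inter> N p)) = {q}" by (auto simp: card_1_singleton_iff)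
  then have qp: "q \<in> N p" "q \<noteq> x" "q \<notin> N x" by auto
  have "q \<noteq> m x" using disjoint_mate[OF x p] qp N_sym by blast
  have sub: "N p \<inter> N q \<subseteq> N x \<inter> N p"
  proof
    fix z assume z: "z \<in> N p \<inter> N q"
    then have "z \<noteq> q" "z \<noteq> x" using N_irrefl[of q] qp(3) N_sym[of q x] by auto
    then show "z \<in> N x \<inter> N p" using z q by blast
  qed
  have "card (N p \<inter> N q) = 2" using card_common_pos_b0[OF qp(1)] a by simp
  then have "N p \<inter> N q = N x \<inter> N p" using card_seteq[OF _ sub] c2 N_finite by simp
  then have "insert p (N x \<inter> N p) \<subseteq> N x \<inter> N q" using p qp(1) N_sym by auto
  then have "card (insert p (N x \<inter> N p)) \<le> card (N x \<inter> N q)" using N_finite by (intro card_mono) auto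
  then have "3 \<le> card (N x \<inter> N q)" using c2 N_irrefl[of p] N_finite by simp
  then have "c \<ge> 1"
    using card_common_non_b0[of x q] x qp \<open>q \<noteq> m x\<close> N_V(2)[OF qp(1)]
    by (cases "q \<in> N (m x)") simp_all
  then have "0 \<le> c * (int (card V) - 6)" using card_V_ge by simp
  then show False using param_count_b0 a by simp
qed

text \<open>Here \<open>c = 0\<close>. In a positive triangle \<open>x\<close>, \<open>p\<close>,
  \<open>r\<close>, each of \<open>m p\<close>, \<open>m r\<close> has two common positive
  neighbours with \<open>x\<close>, necessarily those in \<open>N x - {p, r}\<close>. So the
  positive edge between \<open>m p\<close> and \<open>m r\<close> has two common neighbours instead
  of one.\<close>

lemma a_neq_1: "a \<noteq> 1"
proof
  assume a: "a = 1"
  then have c: "c = 0" using param_count_b0 card_V_ge_10 by simp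
  obtain x where x: "x \<in> V" using nonempty by blast
  then obtain p where p: "p \<in> N x" using N_card[OF x] by fastforce
  have "card (N x \<inter> N p) = 1" using card_common_pos_b0[OF p] a by simp
  then obtain r where r: "N x \<inter> N p = {r}" by (auto simp: card_1_singleton_iff)
  then have rx: "r \<in> N x" "r \<in> N p" by auto
  have cD: "card (N x - {p, r}) = 2"
    using p rx N_irrefl[of p] N_card[OF x] by (subst card_Diff_subset) (auto simp: card_insert_if)
  have far: "N x - {p, r} \<subseteq> N (m y)" if y: "y \<in> {p, r}" for y
  proof -
    have yN: "y \<in> N x" using y p rx by auto
    have yV: "y \<in> V" "p \<in> V" "r \<in> V" using yN p rx N_V by auto
    have "p \<in> N y \<or> p = y" "r \<in> N y \<or> r = y" using y rx N_sym by auto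
    then have "p \<notin> N (m y)" "r \<notin> N (m y)"
      using disjoint_mate[of y] m_notin_N[of y] yV N_sym by auto
    then have sub: "N x \<inter> N (m y) \<subseteq> N x - {p, r}" by auto
    have "card (N x \<inter> N (m y)) = 2" using card_common_mate_nbr[OF x yN] c by simp
    then have "N x \<inter> N (m y) = N x - {p, r}" using card_seteq[OF _ sub] cD N_finite by simp
    then show ?thesis by auto
  qed
  have "m r \<in> N (m p)" using mate_aut[of p r] rx N_V by blast
  then have "card (N (m p) \<inter> N (m r)) = 1" using card_common_pos_b0 a by fastforce
  moreover have "card (N x - {p, r}) \<le> card (N (m p) \<inter> N (m r))"
    using far N_finite by (intro card_mono) auto
  ultimately show False using cD by simp
qed

section \<open>The two graphs with b = 0\<close>

text \<open>The ends of a positive edge share all their other positive neighbours, so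
  \<open>x\<close> and \<open>N x\<close> form a positive clique. A common positive neighbour of
  \<open>x\<close> and \<open>m p\<close> would be joined to both \<open>p\<close> and
  \<open>m p\<close>; hence c = -2 and the order is 10.\<close>

lemma iso_S3:
  assumes a: "a = 3"
  shows "sg_iso V s S3_V S3_s"
proof -
  obtain x where x: "x \<in> V" using nonempty by blast
  have clique: "N y - {p} \<subseteq> N p" if p: "p \<in> N y" for p y
  proof -
    have sub: "N y \<inter> N p \<subseteq> N y - {p}" using N_irrefl by auto
    have "card (N y - {p}) = 3" using N_card N_V(1)[OF p] p by (simp add: N_finite)
    then have "N y \<inter> N p = N y - {p}"
      using card_seteq[OF _ sub] card_common_pos_b0[OF p] a N_finite by simp
    then show ?thesis by auto
  qed
  obtain p where p: "p \<in> N x" using N_card[OF x] by fastforce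
  have "N x \<inter> N (m p) = {}"
  proof (rule ccontr)
    assume "N x \<inter> N (m p) \<noteq> {}"
    then obtain z where z: "z \<in> N x" "z \<in> N (m p)" by blast
    have pV: "p \<in> V" using p N_V by blast
    have "z \<noteq> p" using z m_notin_N[OF pV] N_sym by blast
    then have "z \<in> N p" using clique[OF p] z by blast
    then show False using disjoint_mate[OF pV] z by blast
  qed
  then have c: "c = -2" using card_common_mate_nbr[OF x p] by simp
  then have n: "card V = 10" using param_count_b0 a by simp
  let ?A = "insert x (N x)"
  have A: "s u w = 1" if "u \<in> ?A" "w \<in> ?A" "u \<noteq> w" for u w
  proof -
    have "w \<in> N u" using that clique[of u x] N_sym by auto
    then show ?thesis by (simp add: N_def)
  qed
  have AV: "?A \<subseteq> V" using x N_V by auto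
  have AN: "w \<in> N u" if "u \<in> ?A" "w \<in> ?A" "u \<noteq> w" for u w using A[OF that] by (simp add: N_def)
  have "sg_iso V s {0..<10} S3_s"
  proof (rule half_iso[of ?A, where p=1 and q=0])
    show "card ?A = 5" using N_card[OF x] N_finite N_irrefl by simp
    show "?A \<inter> m ` ?A = {}"
    proof -
      have "u \<noteq> m w" if "u \<in> ?A" "w \<in> ?A" for u w
        using AN[OF that(2,1)] m_notin_N[of w] m_neq[of w] AV that by (cases "u = w") auto
      then show ?thesis by blast
    qed
    show "s u w = 1 \<and> s (m u) (m w) = 1" if "u \<in> ?A" "w \<in> ?A" "u \<noteq> w" for u w
      using AN[OF that] mate_aut[of u w] AV that by (auto simp: N_def)
    show "s u (m w) = 0" if "u \<in> ?A" "w \<in> ?A" "u \<noteq> w" for u w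
    proof -
      have "u \<in> V" "w \<in> V" using that AV by auto
      then show ?thesis
        using AN[OF that] mate_nbr_notin[of u w] s_eq[of u "m w"] that(3) m_eq_iff[of w u] by simp
    qed
    show "S3_s i j = (if (i < 5) = (j < 5) then if i = j then 0 else 1
               else if i mod 5 = j mod 5 then -1 else 0)" if "i < 10" "j < 10" for i j
      using that by (cases "i = j") (simp_all add: S3_s_def S3_V_def)
  qed (use AV n in auto)
  then show ?thesis by (simp add: S3_V_def)
qed

text \<open>From c(n - 6) = 4 and n at least 10 follow c = 1 and n = 10. There are no positive
  triangles, and one side of the bipartition is \<open>x\<close> with the mates of its positive
  neighbours.\<close>

lemma iso_S2:
  assumes a: "a = 0"
  shows "sg_iso V s S2_V S2_s"
proof -
  have cn: "c * (int (card V) - 6) = 4" using param_count_b0 a by simp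
  have c: "c = 1"
  proof (rule ccontr)
    assume "c \<noteq> 1"
    moreover have "c > 0" using cn card_V_ge_10 mult_nonpos_nonneg[of c "int (card V) - 6"] by fastforce
    ultimately have "2 * 4 \<le> c * (int (card V) - 6)" using card_V_ge_10 by (intro mult_mono) auto
    then show False using cn by simp
  qed
  then have n: "card V = 10" using cn by simp
  obtain x where x: "x \<in> V" using nonempty by blast
  have NV: "N x \<subseteq> V" using N_V by blast
  let ?A = "insert x (m ` N x)"
  have AV: "?A \<subseteq> V" using x NV m_V by auto
  have free: "w \<notin> N u" if "u \<in> N x" "w \<in> N x" for u w
  proof
    assume "w \<in> N u"
    then have "w \<in> N x \<inter> N u" using that by blast
    then have "card (N x \<inter> N u) \<noteq> 0" using N_finite by auto
    then show False using card_common_pos_b0[OF that(1)] a by simp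
  qed
  \<comment> \<open>\<open>x\<close> and \<open>m u\<close> have c + 2 = 3 common positive
    neighbours, which must be all of \<open>N x\<close> except \<open>u\<close>.\<close>
  have far: "w \<in> N (m u)" if u: "u \<in> N x" and w: "w \<in> N x" "w \<noteq> u" for u w
  proof -
    have "u \<notin> N (m u)" using m_notin_N[of u] u NV N_sym by blast
    then have sub: "N x \<inter> N (m u) \<subseteq> N x - {u}" by auto
    have "card (N x \<inter> N (m u)) = 3" using card_common_mate_nbr[OF x u] c by simp
    moreover have "card (N x - {u}) = 3" using N_card[OF x] u by (simp add: N_finite)
    ultimately have "N x \<inter> N (m u) = N x - {u}" using card_seteq[OF _ sub] N_finite by simp
    then show ?thesis using w by auto
  qed
  have indep: "w \<notin> N u" if "u \<in> ?A" "w \<in> ?A" for u w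
  proof -
    have "m v \<notin> N x" "x \<notin> N (m v)" if "v \<in> N x" for v
      using mate_nbr_notin[OF x that] N_sym by auto
    moreover have "m v \<notin> N (m v')" if "v \<in> N x" "v' \<in> N x" for v v'
      using free[OF that(2,1)] mate_aut[of v' v] that NV by blast
    ultimately show ?thesis using that N_irrefl[of x] by auto
  qed
  have cross: "m w \<in> N u" if "u \<in> ?A" "w \<in> ?A" "u \<noteq> w" for u w
  proof -
    have "m (m v) = v" if "v \<in> N x" for v using that NV m_m by blast
    moreover have "m x \<in> N (m v)" if "v \<in> N x" for v using that mate_aut[of v x] NV x N_sym by blast
    moreover have "m w \<in> N x" if "u = x" "w \<in> m ` N x"
      using that calculation(1) by auto
    moreover have "v \<in> N (m v')" if "u = m v'" "w = m v" "v \<in> N x" "v' \<in> N x" for v v'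
      using far[of v' v] that \<open>u \<noteq> w\<close> by auto
    ultimately show ?thesis using \<open>u \<in> ?A\<close> \<open>w \<in> ?A\<close> \<open>u \<noteq> w\<close> by auto
  qed
  have "sg_iso V s {0..<10} S2_s"
  proof (rule half_iso[of ?A, where p=0 and q=1])
    have "x \<notin> m ` N x" using NV m_notin_N[OF x] m_m by (metis imageE subsetD)
    then show "card ?A = 5" using N_card[OF x] N_finite m_image_card[OF NV] by simp
    show disj: "?A \<inter> m ` ?A = {}"
    proof -
      have "u \<noteq> m w" if "u \<in> ?A" "w \<in> ?A" for u w
        using cross[OF that] indep[OF that(1,1)] m_neq[of w] AV that by (cases "u = w") auto
      then show ?thesis by blast
    qed
    show "s u w = 0 \<and> s (m u) (m w) = 0" if uw: "u \<in> ?A" "w \<in> ?A" "u \<noteq> w" for u w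
    proof -
      have V: "u \<in> V" "w \<in> V" using uw AV by auto
      have "w \<noteq> m u" using disj uw by blast
      moreover have "m w \<noteq> m (m u)" using \<open>w \<noteq> m u\<close> V by (metis m_m)
      moreover have "m w \<notin> N (m u)" using indep[OF uw(1,2)] mate_aut V by blast
      ultimately show ?thesis using indep[OF uw(1,2)] s_eq V m_V by simp
    qed
    show "s u (m w) = 1" if "u \<in> ?A" "w \<in> ?A" "u \<noteq> w" for u w
      using cross[OF that] by (simp add: N_def)
    show "S2_s i j = (if (i < 5) = (j < 5) then if i = j then 0 else 0
               else if i mod 5 = j mod 5 then -1 else 1)" if "i < 10" "j < 10" for i j
      using that by (cases "(i < 5) = (j < 5)") (simp_all add: S2_s_def S2_V_def)
  qed (use AV n in auto)
  then show ?thesis by (simp add: S2_V_def)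
qed

lemma iso_b0: "sg_iso V s S2_V S2_s \<or> sg_iso V s S3_V S3_s"
proof -
  have "a = 0 \<or> a = 3" using a_range a_neq_1 a_neq_2 by linarith
  then show ?thesis using iso_S2 iso_S3 by blast
qed

end

subsection \<open>The case \<open>b = 4\<close>\<close>

context
  assumes b4: "b = 4"
begin

lemma twin: "x \<in> V \<Longrightarrow> N (m x) = N x"
proof -
  assume x: "x \<in> V"
  have "card (N x \<inter> N (m x)) = 4" using card_common_neg[OF x] b4 by simp
  then have "N x \<inter> N (m x) = N x" "N x \<inter> N (m x) = N (m x)"
    using N_card[OF x] N_card[OF m_V[OF x]] N_finite by (intro card_subset_eq; simp)+
  then show ?thesis by simp
qed

lemma m_mem_N_iff: "y \<in> V \<Longrightarrow> m y \<in> N x \<longleftrightarrow> y \<in> N x"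
  using twin[of y] N_sym by blast

text \<open>Each positive neighbourhood is a union of two mate pairs, so one member of each
  determines it. The quotient by \<open>m\<close> is therefore 2-regular.\<close>

lemma N_eq:
  assumes u: "u \<in> N x" and w: "w \<in> N x" "w \<noteq> u" "w \<noteq> m u"
  shows "N x = {u, m u, w, m w}"
proof -
  have V: "x \<in> V" "u \<in> V" "w \<in> V" using u w N_V by auto
  then have m: "m u \<in> N x" "m w \<in> N x" using m_mem_N_iff u w by auto
  have "m w \<noteq> u" "m w \<noteq> m u" using w V m_m m_eq_iff by auto
  then have "card {u, m u, w, m w} = 4"
    using w m_neq V by (simp add: eq_commute)
  then have "{u, m u, w, m w} = N x"
    using u w m N_card[OF V(1)] N_finite by (intro card_subset_eq) auto
  then show ?thesis by simp
qed

lemma N_eqE: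
  assumes u: "u \<in> N x"
  obtains w where "w \<in> N x" "w \<noteq> u" "w \<noteq> m u"
proof -
  have V: "x \<in> V" "u \<in> V" using u N_V by auto
  then have "card (N x - {u, m u}) = 2"
    using u m_mem_N_iff m_neq[of u] N_card[of x] by (subst card_Diff_subset) auto
  then have "N x - {u, m u} \<noteq> {}" by force
  then show thesis using that by blast
qed

text \<open>The list \<open>xs\<close> takes one vertex from each mate pair in cyclic order;
  \<open>closed\<close> and connectedness make these pairs exhaust \<open>V\<close>. Position t
  yields the labels 2t and 2t + 1 of the model.\<close>

lemma cycle_iso:
  assumes k: "length xs = k" "k > 0" and sub: "set xs \<subseteq> V"
    and sep: "sorted_wrt (\<lambda>q r. q \<noteq> r \<and> q \<noteq> m r) xs"
    and closed: "\<And>q. q \<in> set xs \<Longrightarrow> N q \<subseteq> set xs \<union> m ` set xs"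
    and nb: "\<And>p q. p < k \<Longrightarrow> q < k \<Longrightarrow> p \<noteq> q \<Longrightarrow>
       xs ! q \<in> N (xs ! p) \<longleftrightarrow> q = (p + 1) mod k \<or> p = (q + 1) mod k"
  shows "sg_iso V s (S1_V k) (S1_s k)"
proof -
  have sep': "xs ! p \<noteq> xs ! q \<and> xs ! p \<noteq> m (xs ! q)" if "p < k" "q < k" "p \<noteq> q" for p q
  proof (cases "p < q")
    case True
    then show ?thesis using sorted_wrt_nth_less[OF sep True] that k by simp
  next
    case False
    then show ?thesis
      using sorted_wrt_nth_less[OF sep, of q p] that k sub m_eq_swap[of "xs ! q" "xs ! p"] by (auto simp: subset_iff)
  qed
  have xs: "distinct xs" "length xs = k"
    using sep' k by (auto simp: distinct_conv_nth)
  have xs4: "set xs \<inter> m ` set xs = {}"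
  proof -
    have "xs ! p \<noteq> m (xs ! q)" if "p < k" "q < k" for p q
      using sep'[OF that] m_neq[of "xs ! p"] sub k that by (cases "p = q") (auto simp: subset_iff)
    then show ?thesis using k by (auto simp: in_set_conv_nth)
  qed
  have xs3: "set xs \<union> m ` set xs = V"
  proof (rule closed_subset_eq[of "xs ! 0"])
    show "set xs \<union> m ` set xs \<subseteq> V" using sub m_V by auto
    show "N q \<subseteq> set xs \<union> m ` set xs" if "q \<in> set xs \<union> m ` set xs" for q
      using that twin sub closed by blast
    show "m q \<in> set xs \<union> m ` set xs" if "q \<in> set xs \<union> m ` set xs" for q
      using that m_m sub by auto
  qed (use k in auto)
  define g where "g i = (if even i then xs ! (i div 2) else m (xs ! (i div 2)))" for i
  have A: "xs ! p \<in> set xs" if "p < k" for p using that xs(2) by simp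
  then have AV: "xs ! p \<in> V" if "p < k" for p using that xs3 by blast
  have xs_eq: "xs ! p = xs ! q \<longleftrightarrow> p = q" if "p < k" "q < k" for p q
    using that xs by (simp add: nth_eq_iff_index_eq)
  have cross: "xs ! p \<noteq> m (xs ! q)" if "p < k" "q < k" for p q
    using xs4 A that by blast
  have m_eq: "m (xs ! p) = m (xs ! q) \<longleftrightarrow> p = q" if "p < k" "q < k" for p q
    using xs_eq m_eq_iff AV that by simp
  have half: "i div 2 < k" if "i < 2 * k" for i using that by simp
  have inj: "inj_on g {0..<2 * k}"
  proof (rule inj_onI)
    fix i j assume ij: "i \<in> {0..<2 * k}" "j \<in> {0..<2 * k}" "g i = g j"
    then have "i div 2 = j div 2" "even i = even j"
      using xs_eq[OF half half, of i j] m_eq[OF half half, of i j] cross[OF half half, of i j] cross[OF half half, of j i]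
      unfolding g_def by (auto split: if_splits)
    then show "i = j" by (metis div_mult_mod_eq parity_cases)
  qed
  have "g ` {0..<2 * k} = V"
  proof
    show "g ` {0..<2 * k} \<subseteq> V" using AV m_V by (auto simp: g_def)
    show "V \<subseteq> g ` {0..<2 * k}"
    proof
      fix v assume "v \<in> V"
      then obtain p where p: "p < k" "v = xs ! p \<or> v = m (xs ! p)"
        using xs(2) xs3 by (auto simp: in_set_conv_nth)
      then have "v = g (2 * p) \<or> v = g (2 * p + 1)" by (auto simp: g_def)
      then show "v \<in> g ` {0..<2 * k}" using p(1) by auto
    qed
  qed
  then have bij: "bij_betw g {0..<2 * k} V" using inj by (simp add: bij_betw_def)
  have "S1_s k i j = s (g i) (g j)" if ij: "i < 2 * k" "j < 2 * k" for i j
  proof (cases "i div 2 = j div 2")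
    case True
    note h = half[OF ij(1)] half[OF ij(2)]
    have neg: "s (xs ! (j div 2)) (m (xs ! (j div 2))) = -1" using AV[OF h(2)] mate by blast
    have "i = j \<longleftrightarrow> even i = even j" using True by (metis div_mult_mod_eq parity_cases)
    then show ?thesis
      using True ij neg s_irrefl s_sym[of "m _"] by (auto simp: g_def S1_s_def S1_V_def)
  next
    case False
    let ?u = "xs ! (i div 2)" and ?w = "xs ! (j div 2)"
    note h = half[OF ij(1)] half[OF ij(2)]
    have uV: "?u \<in> V" "?w \<in> V" using AV h by auto
    have ne: "?u \<noteq> ?w" "?u \<noteq> m ?w" "m ?u \<noteq> m ?w" "?w \<noteq> m ?u"
      using False xs_eq[OF h] cross[OF h] cross[OF h(2,1)] m_eq[OF h] by auto
    have "s (g i) (g j) = of_bool (?w \<in> N ?u)"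
      using uV ne by (auto simp: g_def s_eq m_V m_m twin m_mem_N_iff)
    also have "\<dots> = S1_s k i j"
      using False ij nb[OF h False] by (auto simp: S1_s_def S1_V_def)
    finally show ?thesis by simp
  qed
  then show ?thesis using sg_iso_enum[OF bij] unfolding S1_V_def by simp
qed

text \<open>Follow the cycle of mate pairs from \<open>x\<close> in both directions, to
  \<open>u\<close> and \<open>v\<close>. Adjacent \<open>u\<close>, \<open>v\<close> close a
  triangle; a next vertex \<open>w\<close> after \<open>u\<close> that meets \<open>v\<close> closes
  a square; otherwise the constancy of \<open>c\<close> closes a pentagon.\<close>

lemma iso_b4: "sg_iso V s (S1_V 3) (S1_s 3) \<or> sg_iso V s (S1_V 4) (S1_s 4) \<or> sg_iso V s (S1_V 5) (S1_s 5)"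
proof -
  have sep_adj: "q \<noteq> r" "q \<noteq> m r" if "r \<in> N q" for q r
    using that N_irrefl m_notin_N[of r] N_sym N_V by auto
  have sep_sym: "r \<noteq> q" "r \<noteq> m q" if "q \<noteq> r" "q \<noteq> m r" "q \<in> V" for q r
    using that m_m by auto
  obtain x where x: "x \<in> V" using nonempty by blast
  have "N x \<noteq> {}" using N_card[OF x] by force
  then obtain u where xu: "u \<in> N x" by blast
  obtain v where xv: "v \<in> N x" and vu: "v \<noteq> u" "v \<noteq> m u" using N_eqE[OF xu] by blast
  have Nx: "N x = {u, m u, v, m v}" by (rule N_eq[OF xu xv vu])
  have ux: "x \<in> N u" and vx: "x \<in> N v" using xu xv N_sym by auto
  have V: "u \<in> V" "v \<in> V" using xu xv N_V by auto
  show ?thesis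
  proof (cases "v \<in> N u")
    case uv: True
    then have vu': "u \<in> N v" using N_sym by blast
    have Nu: "N u = {x, m x, v, m v}" by (rule N_eq[OF ux uv sep_adj[OF vx]])
    have Nv: "N v = {x, m x, u, m u}" by (rule N_eq[OF vx vu' sep_adj[OF ux]])
    have "sg_iso V s (S1_V 3) (S1_s 3)"
    proof (rule cycle_iso[of "[x, u, v]"])
      show "sorted_wrt (\<lambda>q r. q \<noteq> r \<and> q \<noteq> m r) [x, u, v]"
        using sep_adj[OF xu] sep_adj[OF xv] sep_adj[OF uv] by simp
      show "N q \<subseteq> set [x, u, v] \<union> m ` set [x, u, v]" if "q \<in> set [x, u, v]" for q
        using that Nx Nu Nv by auto
      show "[x, u, v] ! q \<in> N ([x, u, v] ! p) \<longleftrightarrow> q = (p + 1) mod 3 \<or> p = (q + 1) mod 3"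
        if "p < 3" "q < 3" "p \<noteq> q" for p q
      proof -
        have "p \<in> {0, 1, 2}" "q \<in> {0, 1, 2}" using that by auto
        then show ?thesis using that(3)
          by (elim insertE emptyE; simp add: xu xv uv ux vx vu')
      qed
    qed (use x V in auto)
    then show ?thesis by blast
  next
    case uv: False
    then have vu': "u \<notin> N v" using N_sym by blast
    obtain w where uw: "w \<in> N u" and wx: "w \<noteq> x" "w \<noteq> m x" using N_eqE[OF ux] by blast
    have Nu: "N u = {x, m x, w, m w}" by (rule N_eq[OF ux uw wx])
    have wu: "u \<in> N w" and wV: "w \<in> V" using uw N_sym N_V by auto
    have xw: "w \<notin> N x"
      using Nx sep_adj[OF wu] uv uw m_mem_N_iff[OF V(2)] by auto
    then have wx': "x \<notin> N w" using N_sym by blast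
    show ?thesis
    proof (cases "w \<in> N v")
      case vw: True
      then have wv: "v \<in> N w" using N_sym by blast
      have Nv: "N v = {x, m x, w, m w}" by (rule N_eq[OF vx vw wx])
      have Nw: "N w = {u, m u, v, m v}" by (rule N_eq[OF wu wv vu])
      have "sg_iso V s (S1_V 4) (S1_s 4)"
      proof (rule cycle_iso[of "[x, u, w, v]"])
        show "sorted_wrt (\<lambda>q r. q \<noteq> r \<and> q \<noteq> m r) [x, u, w, v]"
          using sep_adj[OF xu] sep_adj[OF xv] sep_adj[OF uw] sep_adj[OF wv]
            sep_sym[OF wx wV] sep_sym[OF vu V(2)] by simp
        show "N q \<subseteq> set [x, u, w, v] \<union> m ` set [x, u, w, v]" if "q \<in> set [x, u, w, v]" for q
          using that Nx Nu Nv Nw by auto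
        show "[x, u, w, v] ! q \<in> N ([x, u, w, v] ! p) \<longleftrightarrow> q = (p + 1) mod 4 \<or> p = (q + 1) mod 4"
          if "p < 4" "q < 4" "p \<noteq> q" for p q
        proof -
          have "p \<in> {0, 1, 2, 3}" "q \<in> {0, 1, 2, 3}" using that by auto
          then show ?thesis using that(3)
            by (elim insertE emptyE; simp add: xu xv ux vx uw wu vw wv uv vu' xw wx')
        qed
      qed (use x V wV in auto)
      then show ?thesis by blast
    next
      case vw: False
      then have wv: "v \<notin> N w" using N_sym by blast
      \<comment> \<open>As \<open>v\<close> is not joined to \<open>w\<close>, only the pair of
        \<open>u\<close> is shared, which fixes c = 2.\<close>
      have "N x \<inter> N w = {u, m u}"
        using Nx wu wv m_mem_N_iff V by auto
      then have c: "c = 2"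
        using card_common_non[OF x wV wx xw] m_mem_N_iff[OF wV] xw twin[OF x] m_neq[OF V(1)] by simp
      obtain z where wz: "z \<in> N w" and zu: "z \<noteq> u" "z \<noteq> m u" using N_eqE[OF wu] by blast
      have Nw: "N w = {u, m u, z, m z}" by (rule N_eq[OF wu wz zu])
      have zw: "w \<in> N z" and zV: "z \<in> V" using wz N_sym N_V by auto
      have zx: "z \<noteq> x" "z \<noteq> m x" using wz wx' m_mem_N_iff[OF x] by auto
      have xz: "z \<notin> N x" using Nx zu wz wv m_mem_N_iff[OF V(2)] by auto
      then have zx': "x \<notin> N z" using N_sym by blast
      have uz: "z \<notin> N u" using Nu zx sep_adj[OF zw] by auto
      then have zu': "u \<notin> N z" using N_sym by blast
      \<comment> \<open>\<open>z\<close> is another non-neighbour of \<open>x\<close>, so it too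
        shares a pair with \<open>x\<close>; the pair of \<open>u\<close> is excluded, leaving that
        of \<open>v\<close>.\<close>
      have "card (N x \<inter> N z) = 2"
        using card_common_non[OF x zV zx xz] m_mem_N_iff[OF zV] xz twin[OF x] c by simp
      then have "N x \<inter> N z \<noteq> {}" by force
      then have zv: "v \<in> N z" using Nx zu' m_mem_N_iff V by auto
      then have vz: "z \<in> N v" using N_sym by blast
      have Nv: "N v = {x, m x, z, m z}" by (rule N_eq[OF vx vz zx])
      have wv': "w \<noteq> v" "w \<noteq> m v" using uw uv m_mem_N_iff[OF V(2)] by auto
      have Nz: "N z = {v, m v, w, m w}" by (rule N_eq[OF zv zw wv'])
      have "sg_iso V s (S1_V 5) (S1_s 5)"
      proof (rule cycle_iso[of "[x, u, w, z, v]"])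
        show "sorted_wrt (\<lambda>q r. q \<noteq> r \<and> q \<noteq> m r) [x, u, w, z, v]"
          using sep_adj[OF xu] sep_adj[OF xv] sep_adj[OF uw] sep_adj[OF wz] sep_adj[OF zv] wv'
            sep_sym[OF wx wV] sep_sym[OF zx zV] sep_sym[OF zu zV] sep_sym[OF vu V(2)] by simp
        show "N q \<subseteq> set [x, u, w, z, v] \<union> m ` set [x, u, w, z, v]" if "q \<in> set [x, u, w, z, v]" for q
          using that Nx Nu Nv Nw Nz by auto
        show "[x, u, w, z, v] ! q \<in> N ([x, u, w, z, v] ! p) \<longleftrightarrow> q = (p + 1) mod 5 \<or> p = (q + 1) mod 5"
          if "p < 5" "q < 5" "p \<noteq> q" for p q
        proof -
          have "p \<in> {0, 1, 2, 3, 4}" "q \<in> {0, 1, 2, 3, 4}" using that by auto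
          then show ?thesis using that(3)
            by (elim insertE emptyE;
                simp add: xu xv ux vx uw wu wz zw zv vz uv vu' xw wx' vw wv xz zx' uz zu')
        qed
      qed (use x V wV zV in auto)
      then show ?thesis by blast
    qed
  qed
qed

end

text \<open>The triangle case is \<open>G1_s\<close>: any two distinct residues modulo 3 are
  consecutive, so the lexicographic product is complete on six vertices.\<close>

lemma classification:
  "sg_iso V s G1_V G1_s \<or> sg_iso V s (S1_V 4) (S1_s 4) \<or> sg_iso V s (S1_V 5) (S1_s 5) \<or>
       sg_iso V s S2_V S2_s \<or> sg_iso V s S3_V S3_s"
proof -
  have "S1_V 3 = G1_V" by (simp add: S1_V_def G1_V_def)
  moreover have "S1_s 3 = G1_s"
  proof (intro ext)
    fix x y :: nat
    have "q = (p + 1) mod 3 \<or> p = (q + 1) mod 3" if "p < 3" "q < 3" "p \<noteq> q" for p q :: nat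
    proof -
      have "p \<in> {0, 1, 2}" "q \<in> {0, 1, 2}" using that by auto
      then show ?thesis using that(3) by (elim insertE emptyE; simp)
    qed
    from this[of "x div 2" "y div 2"] show "S1_s 3 x y = G1_s x y"
      by (simp add: S1_s_def G1_s_def S1_V_def G1_V_def less_mult_imp_div_less)
  qed
  ultimately show ?thesis using b_cases b_neq_2 iso_b0 iso_b4 by auto
qed

end

section \<open>From degree and net-degree to the matching\<close>

lemma matched_srsgI:
  assumes "is_5_3_srsg V s"
  obtains m a b c where "matched_srsg V s m a b c"
proof -
  have sg: "signed_graph V s" and reg: "regular V s 5" and net: "net_regular V s 3"
    and conn: "sg_connected V s" using assms by (auto simp: is_5_3_srsg_def)
  obtain r a b c where sr: "srsg_with V s r a b c" using assms by (auto simp: is_5_3_srsg_def srsg_def)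
  have pn: "pos_deg V s x = 4" "neg_deg V s x = 1" if "x \<in> V" for x
    using reg net that deg_eq_pos_neg[OF sg, of x] unfolding regular_def net_regular_def by fastforce+
  have V: "y \<in> V" if "s x y \<noteq> 0" for x y using sg that by (auto simp: signed_graph_def)
  have neg: "\<exists>z. \<forall>y. s x y = -1 \<longleftrightarrow> y = z" if x: "x \<in> V" for x
  proof -
    obtain z where "{y \<in> V. s x y = -1} = {z}"
      using pn(2)[OF x] by (auto simp: neg_deg_def card_1_singleton_iff)
    then have "y \<in> V \<and> s x y = -1 \<longleftrightarrow> y = z" for y by blast
    moreover have "y \<in> V" if "s x y = -1" for y using V[of x y] that by simp
    ultimately show ?thesis by blast
  qed
  define m where "m x = (SOME z. \<forall>y. s x y = -1 \<longleftrightarrow> y = z)" for x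
  have "matched_srsg V s m a b c"
  proof
    show "V \<noteq> {}" using sr by (auto simp: srsg_with_def edgeless_def)
    show "card {y. s x y = 1} = 4" if "x \<in> V" for x
    proof -
      have "{y. s x y = 1} = {y \<in> V. s x y = 1}" using V[of x] by auto
      then show ?thesis using pn(1)[OF that] by (simp add: pos_deg_def)
    qed
    show "s x y = -1 \<longleftrightarrow> y = m x" if "x \<in> V" for x y
      using someI_ex[OF neg[OF that]] unfolding m_def by blast
  qed (use sg conn sr in \<open>auto simp: srsg_with_def\<close>)
  then show thesis by (rule that)
qed

subsection \<open>The five graphs\<close>

text \<open>All degrees and entries of A^2 in a single condition over explicit lists, so that
  rewriting can evaluate it on each concrete graph.\<close>

definition srsg_table :: "nat \<Rightarrow> (nat \<Rightarrow> nat \<Rightarrow> int) \<Rightarrow> int \<Rightarrow> int \<Rightarrow> int \<Rightarrow> bool" where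
  "srsg_table n s a b c \<longleftrightarrow> (\<forall>x\<in>set [0..<n].
     length (filter (\<lambda>y. s x y = 1) [0..<n]) = 4 \<and> length (filter (\<lambda>y. s x y = -1) [0..<n]) = 1 \<and>
     (\<forall>y\<in>set [0..<n]. (\<Sum>z\<leftarrow>[0..<n]. s x z * s z y) =
       (if x = y then 5 else if s x y = 1 then a else if s x y = -1 then b else c)))"

lemma srsg_table_pos_deg:
  assumes "srsg_table n s a b c" "x < n"
  shows "pos_deg {0..<n} s x = 4"
proof -
  have "pos_deg {0..<n} s x = card (set (filter (\<lambda>y. s x y = 1) [0..<n]))"
    unfolding pos_deg_def by (rule arg_cong[where f=card]) auto
  also have "\<dots> = length (filter (\<lambda>y. s x y = 1) [0..<n])"
    by (simp only: distinct_card distinct_filter distinct_upt)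
  finally show ?thesis using assms unfolding srsg_table_def by simp
qed

lemma srsg_table_neg_deg:
  assumes "srsg_table n s a b c" "x < n"
  shows "neg_deg {0..<n} s x = 1"
proof -
  have "neg_deg {0..<n} s x = card (set (filter (\<lambda>y. s x y = -1) [0..<n]))"
    unfolding neg_deg_def by (rule arg_cong[where f=card]) auto
  also have "\<dots> = length (filter (\<lambda>y. s x y = -1) [0..<n])"
    by (simp only: distinct_card distinct_filter distinct_upt)
  finally show ?thesis using assms unfolding srsg_table_def by simp
qed

lemma srsg_table_A2:
  assumes "srsg_table n s a b c" "x < n" "y < n"
  shows "A2 {0..<n} s x y = (if x = y then 5 else if s x y = 1 then a else if s x y = -1 then b else c)"
proof -
  have "A2 {0..<n} s x y = (\<Sum>z\<leftarrow>[0..<n]. s x z * s z y)"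
    unfolding A2_def by (simp add: interv_sum_list_conv_sum_set_nat)
  then show ?thesis using assms unfolding srsg_table_def by simp
qed

text \<open>Vertex 0 lies on a positive and on a negative edge, so the graph is neither homogeneous
  nor edgeless.\<close>

lemma srsg_table_srsg_with:
  assumes sg: "signed_graph {0..<n} s" and tb: "srsg_table n s a b c" and n: "0 < n"
  shows "srsg_with {0..<n} s 5 a b c"
proof -
  have "pos_deg {0..<n} s 0 \<noteq> 0" "neg_deg {0..<n} s 0 \<noteq> 0"
    using srsg_table_pos_deg[OF tb n] srsg_table_neg_deg[OF tb n] by simp_all
  then obtain y z where "y < n" "s 0 y = 1" "z < n" "s 0 z = -1"
    unfolding pos_deg_def neg_deg_def by (auto simp: card_eq_0_iff)
  then have "\<not> homogeneous {0..<n} s" "\<not> edgeless {0..<n} s"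
    using n unfolding homogeneous_def edgeless_def by force+
  then show ?thesis
    using sg srsg_table_A2[OF tb] unfolding srsg_with_def
    by (auto simp: signed_graph_def)
qed

text \<open>As \<open>c \<noteq> 0\<close>, any two non-adjacent vertices have a common neighbour.\<close>

lemma srsg_with_connected:
  assumes sr: "srsg_with V s r a b c" and c: "c \<noteq> 0"
  shows "sg_connected V s"
  unfolding sg_connected_def
proof (intro ballI)
  fix x y assume xy: "x \<in> V" "y \<in> V"
  show "(adj V s)\<^sup>*\<^sup>* x y"
  proof (cases "x = y \<or> s x y \<noteq> 0")
    case True
    then show ?thesis using xy by (auto simp: adj_def)
  next
    case False
    then have "A2 V s x y \<noteq> 0" using sr c xy by (simp add: srsg_with_def)
    then obtain z where "z \<in> V" "s x z * s z y \<noteq> 0"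
      unfolding A2_def by (meson sum.neutral)
    then have "adj V s x z" "adj V s z y" using xy by (auto simp: adj_def)
    then show ?thesis by (meson r_into_rtranclp rtranclp_trans)
  qed
qed

lemma srsg_table_is_5_3_srsg:
  assumes sg: "signed_graph {0..<n} s" and tb: "srsg_table n s a b c" and n: "0 < n" and c: "c \<noteq> 0"
  shows "is_5_3_srsg {0..<n} s"
  unfolding is_5_3_srsg_def
proof (intro conjI)
  show "sg_connected {0..<n} s"
    using srsg_with_connected[OF srsg_table_srsg_with[OF sg tb n] c] .
  show "regular {0..<n} s 5"
    by (simp add: regular_def deg_eq_pos_neg[OF sg] srsg_table_pos_deg[OF tb] srsg_table_neg_deg[OF tb])
  show "net_regular {0..<n} s 3"
    by (simp add: net_regular_def srsg_table_pos_deg[OF tb] srsg_table_neg_deg[OF tb])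
  show "srsg {0..<n} s"
    using srsg_table_srsg_with[OF sg tb n] unfolding srsg_def by blast
qed (rule sg)

section \<open>Evaluation of the tables and symmetry of the models\<close>

lemma upt_enum:
  "[0..<6] = [0,1,2,3,4,5::nat]" "[0..<8] = [0,1,2,3,4,5,6,7::nat]"
  "[0..<10] = [0,1,2,3,4,5,6,7,8,9::nat]"
  by (simp_all add: upt_rec)

text \<open>In a complete graph no pair constrains \<open>c\<close>; the value 1 is chosen because
  the connectedness criterion asks for a nonzero \<open>c\<close>.\<close>

lemma G1_table: "srsg_table 6 G1_s 0 4 1"
  unfolding srsg_table_def upt_enum G1_s_def G1_V_def atLeastLessThan_iff by simp

lemma S1_4_table: "srsg_table 8 (S1_s 4) (-2) 4 4"
  unfolding srsg_table_def upt_enum S1_s_def S1_V_def atLeastLessThan_iff by simp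

lemma S1_5_table: "srsg_table 10 (S1_s 5) (-2) 4 2"
  unfolding srsg_table_def upt_enum S1_s_def S1_V_def atLeastLessThan_iff by simp

lemma S2_table: "srsg_table 10 S2_s 0 0 1"
  unfolding srsg_table_def upt_enum S2_s_def S2_V_def atLeastLessThan_iff by simp

lemma S3_table: "srsg_table 10 S3_s 3 0 (-2)"
  unfolding srsg_table_def upt_enum S3_s_def S3_V_def atLeastLessThan_iff by simp

text \<open>The models share this nested conditional, so symmetry of the sign function reduces to
  symmetry of three relations.\<close>

lemma signed_graph_ifI:
  assumes "finite V"
    and s: "\<And>x y. s x y = (if R x y then if S x y then -1 else if T x y then 1 else 0 else 0)"
    and R: "\<And>x y. R x y \<Longrightarrow> x \<in> V \<and> y \<in> V \<and> x \<noteq> y"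
    and "symp R" "symp S" "symp T"
  shows "signed_graph V s"
proof -
  have "R x y \<longleftrightarrow> R y x" "S x y \<longleftrightarrow> S y x" "T x y \<longleftrightarrow> T y x" for x y
    using assms(4-6) by (blast dest: sympD)+
  then show ?thesis
    using assms(1) R unfolding signed_graph_def s by (simp split: if_splits) blast
qed

lemma signed_graph_G1: "signed_graph {0..<6} G1_s"
  by (rule signed_graph_ifI[where R="\<lambda>x y. x \<in> G1_V \<and> y \<in> G1_V \<and> x \<noteq> y"
        and S="\<lambda>x y. x div 2 = y div 2" and T="\<lambda>x y. True"])
     (rule finite_atLeastLessThan, unfold if_True, rule G1_s_def, auto simp: symp_def G1_V_def)

lemma signed_graph_S1: "signed_graph {0..<2 * m} (S1_s m)"
  by (rule signed_graph_ifI[where R="\<lambda>x y. x \<in> S1_V m \<and> y \<in> S1_V m \<and> x \<noteq> y"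
        and S="\<lambda>x y. x div 2 = y div 2"
        and T="\<lambda>x y. y div 2 = (x div 2 + 1) mod m \<or> x div 2 = (y div 2 + 1) mod m"])
     (rule finite_atLeastLessThan, rule S1_s_def, auto simp: symp_def S1_V_def)

lemma signed_graph_S1_4: "signed_graph {0..<8} (S1_s 4)"
  and signed_graph_S1_5: "signed_graph {0..<10} (S1_s 5)"
  using signed_graph_S1[of 4] signed_graph_S1[of 5] by simp_all

lemma signed_graph_S2: "signed_graph {0..<10} S2_s"
  by (rule signed_graph_ifI[where R="\<lambda>x y. x \<in> S2_V \<and> y \<in> S2_V \<and> (x < 5) \<noteq> (y < 5)"
        and S="\<lambda>x y. x mod 5 = y mod 5" and T="\<lambda>x y. True"])
     (rule finite_atLeastLessThan, unfold if_True, rule S2_s_def, auto simp: symp_def S2_V_def)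

text \<open>The definition tests for positive edges first; taking \<open>S\<close> to include
  \<open>(x < 5) \<noteq> (y < 5)\<close> lets the negative test come first.\<close>

lemma signed_graph_S3: "signed_graph {0..<10} S3_s"
  by (rule signed_graph_ifI[where R="\<lambda>x y. x \<in> S3_V \<and> y \<in> S3_V \<and> x \<noteq> y"
        and S="\<lambda>x y. (x < 5) \<noteq> (y < 5) \<and> x mod 5 = y mod 5" and T="\<lambda>x y. (x < 5) = (y < 5)"])
     (rule finite_atLeastLessThan, simp add: S3_s_def, auto simp: symp_def S3_V_def)

lemma vertex_sets:
  "G1_V = {0..<6}" "S1_V 4 = {0..<8}" "S1_V 5 = {0..<10}" "S2_V = {0..<10}" "S3_V = {0..<10}"
  by (simp_all add: G1_V_def S1_V_def S2_V_def S3_V_def)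

lemma G1_params: "srsg_params4 {0..<6} G1_s 6 5 0 4"
  using srsg_table_srsg_with[OF signed_graph_G1 G1_table]
  by (auto simp: srsg_params4_def complete_def G1_s_def G1_V_def)

lemma srsg_table_params5:
  assumes "signed_graph {0..<n} s" "srsg_table n s a b c" "x < n" "y < n" "x \<noteq> y" "s x y = 0"
  shows "srsg_params5 {0..<n} s n 5 a b c"
  using srsg_table_srsg_with[OF assms(1,2)] assms(3-6)
  by (fastforce simp: srsg_params5_def complete_def)

section \<open>Pairwise non-isomorphism\<close>

text \<open>An isomorphism invariant that recovers \<open>a\<close> from the graph; the pairs of
  order and \<open>a\<close> differ for all five graphs.\<close>

definition pos_edge_A2 :: "'a set \<Rightarrow> ('a \<Rightarrow> 'a \<Rightarrow> int) \<Rightarrow> int set" where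
  "pos_edge_A2 V s = {A2 V s x y | x y. x \<in> V \<and> y \<in> V \<and> s x y = 1}"

lemma sg_iso_card: "sg_iso V s W t \<Longrightarrow> card V = card W"
  unfolding sg_iso_def using bij_betw_same_card by blast

lemma sg_iso_pos_edge_A2:
  assumes "sg_iso V s W t"
  shows "pos_edge_A2 V s = pos_edge_A2 W t"
proof -
  obtain f where f: "bij_betw f V W" and hom: "\<And>x y. x \<in> V \<Longrightarrow> y \<in> V \<Longrightarrow> t (f x) (f y) = s x y"
    using assms unfolding sg_iso_def by blast
  have A2: "A2 W t (f x) (f y) = A2 V s x y" if "x \<in> V" "y \<in> V" for x y
    unfolding A2_def sum.reindex_bij_betw[OF f, symmetric] using that hom by simp
  have W: "W = f ` V" using f by (simp add: bij_betw_def)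
  have "pos_edge_A2 W t = {A2 W t (f x) (f y) | x y. x \<in> V \<and> y \<in> V \<and> t (f x) (f y) = 1}"
    unfolding pos_edge_A2_def W by blast
  also have "\<dots> = pos_edge_A2 V s"
    unfolding pos_edge_A2_def using A2 hom by (intro Collect_cong ex_cong1) auto
  finally show ?thesis by simp
qed

lemma srsg_table_pos_edge_A2:
  assumes sg: "signed_graph {0..<n} s" and tb: "srsg_table n s a b c" and n: "0 < n"
  shows "pos_edge_A2 {0..<n} s = {a}"
proof -
  have "pos_deg {0..<n} s 0 \<noteq> 0" using srsg_table_pos_deg[OF tb n] by simp
  then obtain y where "y < n" "s 0 y = 1"
    unfolding pos_deg_def by (auto simp: card_eq_0_iff)
  moreover have "A2 {0..<n} s x y = a" if "x < n" "y < n" "s x y = 1" for x y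
    using srsg_table_srsg_with[OF sg tb n] that unfolding srsg_with_def by simp
  ultimately show ?thesis
    unfolding pos_edge_A2_def using n by auto (metis n)
qed

lemma examples_not_iso:
  assumes gs: "gs = [(G1_V, G1_s), (S1_V 4, S1_s 4), (S1_V 5, S1_s 5), (S2_V, S2_s), (S3_V, S3_s)]"
    and "i < 5" "j < 5" "i \<noteq> j"
  shows "\<not> sg_iso (fst (gs ! i)) (snd (gs ! i)) (fst (gs ! j)) (snd (gs ! j))"
proof
  define invar where "invar k = (card (fst (gs ! k)), pos_edge_A2 (fst (gs ! k)) (snd (gs ! k)))" for k
  assume "sg_iso (fst (gs ! i)) (snd (gs ! i)) (fst (gs ! j)) (snd (gs ! j))"
  then have eq: "invar i = invar j"
    unfolding invar_def by (simp add: sg_iso_card sg_iso_pos_edge_A2)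
  have "invar 0 = (6, {0})" "invar 1 = (8, {-2})" "invar 2 = (10, {-2})" "invar 3 = (10, {0})" "invar 4 = (10, {3})"
    unfolding invar_def gs vertex_sets
    using srsg_table_pos_edge_A2[OF signed_graph_G1 G1_table]
      srsg_table_pos_edge_A2[OF signed_graph_S1_4 S1_4_table]
      srsg_table_pos_edge_A2[OF signed_graph_S1_5 S1_5_table]
      srsg_table_pos_edge_A2[OF signed_graph_S2 S2_table]
      srsg_table_pos_edge_A2[OF signed_graph_S3 S3_table]
    by simp_all
  moreover have "i \<in> {0,1,2,3,4}" "j \<in> {0,1,2,3,4}" using assms(2,3) by auto
  ultimately show False using eq \<open>i \<noteq> j\<close> by auto
qed

lemma examples:
   "is_5_3_srsg G1_V G1_s \<and> is_5_3_srsg (S1_V 4) (S1_s 4) \<and> is_5_3_srsg (S1_V 5) (S1_s 5)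
   \<and> is_5_3_srsg S2_V S2_s \<and> is_5_3_srsg S3_V S3_s
   \<and> srsg_params4 G1_V G1_s 6 5 0 4
   \<and> srsg_params5 (S1_V 4) (S1_s 4) 8 5 (-2) 4 4
   \<and> srsg_params5 (S1_V 5) (S1_s 5) 10 5 (-2) 4 2
   \<and> srsg_params5 S2_V S2_s 10 5 0 0 1
   \<and> srsg_params5 S3_V S3_s 10 5 3 0 (-2)"
  unfolding vertex_sets
proof (intro conjI)
  show "is_5_3_srsg {0..<6} G1_s"
    by (rule srsg_table_is_5_3_srsg[OF signed_graph_G1 G1_table]) simp_all
  show "is_5_3_srsg {0..<8} (S1_s 4)"
    by (rule srsg_table_is_5_3_srsg[OF signed_graph_S1_4 S1_4_table]) simp_all
  show "is_5_3_srsg {0..<10} (S1_s 5)"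
    by (rule srsg_table_is_5_3_srsg[OF signed_graph_S1_5 S1_5_table]) simp_all
  show "is_5_3_srsg {0..<10} S2_s"
    by (rule srsg_table_is_5_3_srsg[OF signed_graph_S2 S2_table]) simp_all
  show "is_5_3_srsg {0..<10} S3_s"
    by (rule srsg_table_is_5_3_srsg[OF signed_graph_S3 S3_table]) simp_all
  show "srsg_params4 {0..<6} G1_s 6 5 0 4"
    by (rule G1_params)
  \<comment> \<open>Non-adjacent witnesses: 0 and 4 lie in the pairs 0 and 2, not consecutive modulo
    4 or 5; below, 0 and 1 are on one side of the bipartition, and 0 and 6 are in different cliques
    without being mates.\<close>
  show "srsg_params5 {0..<8} (S1_s 4) 8 5 (-2) 4 4"
    by (rule srsg_table_params5[OF signed_graph_S1_4 S1_4_table, of 0 4]) (simp_all add: S1_s_def)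
  show "srsg_params5 {0..<10} (S1_s 5) 10 5 (-2) 4 2"
    by (rule srsg_table_params5[OF signed_graph_S1_5 S1_5_table, of 0 4]) (simp_all add: S1_s_def)
  show "srsg_params5 {0..<10} S2_s 10 5 0 0 1"
    by (rule srsg_table_params5[OF signed_graph_S2 S2_table, of 0 1]) (simp_all add: S2_s_def)
  show "srsg_params5 {0..<10} S3_s 10 5 3 0 (-2)"
    by (rule srsg_table_params5[OF signed_graph_S3 S3_table, of 0 6]) (simp_all add: S3_s_def)
qed

theorem theorem3p3:
  shows
  "(\<forall>(V :: 'a set) s. is_5_3_srsg V s \<longrightarrow>
       sg_iso V s G1_V G1_s \<or> sg_iso V s (S1_V 4) (S1_s 4) \<or> sg_iso V s (S1_V 5) (S1_s 5) \<or>
       sg_iso V s S2_V S2_s \<or> sg_iso V s S3_V S3_s)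
   \<and> is_5_3_srsg G1_V G1_s \<and> is_5_3_srsg (S1_V 4) (S1_s 4) \<and> is_5_3_srsg (S1_V 5) (S1_s 5)
   \<and> is_5_3_srsg S2_V S2_s \<and> is_5_3_srsg S3_V S3_s
   \<and> srsg_params4 G1_V G1_s 6 5 0 4
   \<and> srsg_params5 (S1_V 4) (S1_s 4) 8 5 (-2) 4 4
   \<and> srsg_params5 (S1_V 5) (S1_s 5) 10 5 (-2) 4 2
   \<and> srsg_params5 S2_V S2_s 10 5 0 0 1
   \<and> srsg_params5 S3_V S3_s 10 5 3 0 (-2)
   \<and> (let gs = [(G1_V, G1_s), (S1_V 4, S1_s 4), (S1_V 5, S1_s 5), (S2_V, S2_s), (S3_V, S3_s)]
      in \<forall>i<5. \<forall>j<5. i \<noteq> j \<longrightarrow>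
           \<not> sg_iso (fst (gs ! i)) (snd (gs ! i)) (fst (gs ! j)) (snd (gs ! j)))"
proof (intro conjI)
  show "\<forall>(V :: 'a set) s. is_5_3_srsg V s \<longrightarrow>
       sg_iso V s G1_V G1_s \<or> sg_iso V s (S1_V 4) (S1_s 4) \<or> sg_iso V s (S1_V 5) (S1_s 5) \<or>
       sg_iso V s S2_V S2_s \<or> sg_iso V s S3_V S3_s"
    using matched_srsgI matched_srsg.classification by metis
  show "let gs = [(G1_V, G1_s), (S1_V 4, S1_s 4), (S1_V 5, S1_s 5), (S2_V, S2_s), (S3_V, S3_s)]
      in \<forall>i<5. \<forall>j<5. i \<noteq> j \<longrightarrow>
           \<not> sg_iso (fst (gs ! i)) (snd (gs ! i)) (fst (gs ! j)) (snd (gs ! j))"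
    unfolding Let_def using examples_not_iso[OF refl] by blast
qed (use examples in blast)+

end
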